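(* Let $M$ be a smooth closed connected oriented $n$-manifold, $n\ge3$, and let $g:[0,T)\to\mathcal M_{-1}$ be a non-static conformal Ricci flow with conformal pressure $p:[0,T)\to\mathcal P$. Let $D\subseteq M$ be a domain in $M$ (a nonempty open connected subset), possibly all of $M$, and let $\mathrm{vol}(D,g)=\int_D d\mu_g$ denote the volume of the domain using the time-dependent metric $g$. Then on $[0,T)$, $$\frac{d}{dt}\mathrm{vol}(D,g)=-\tfrac n2\int_D p\,d\mu_g<0 .$$ Thus $\mathrm{vol}(D,g)$ is a strictly monotonically decreasing function along the non-static flow lines of the conformal Ricci flow. In particular, if $D=M$, $$\frac{d}{dt}\mathrm{vol}(M,g)=-\tfrac n2\int_M p\,d\mu_g<0 .$$
   Context: $\mathcal M$: smooth Riemannian metrics on $M$ ($C^\infty$ topology); $\mathcal F=C^\infty(M,\mathbb R)$; $\mathcal P=C^\infty(M,(0,\infty))$; $\mathcal M_{-1}=\{g\in\mathcal M\mid R(g)=-1\}$; $\mathrm{Ric}(g)$, $R(g)$: Ricci tensor and scalar curvature; $d\mu_g$: volume element. A conformal Ricci flow with conformal pressure $p$ is a pair of curves $g:[0,T)\to\mathcal M$, $p:[0,T)\to\mathcal F$, $0<T\le\infty$, continuous on $[0,T)$ and smooth on $(0,T)$, with $g(0)=g_0\in\mathcal M_{-1}$, satisfying $$\frac{\partial g}{\partial t}+2\Big(\mathrm{Ric}(g)+\tfrac1n g\Big)=-p\,g,\qquad R(g)=-1 .$$ Time derivatives at $t=0$ are one-sided. The flow is static if it is the constant curve $g(t)\equiv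 g_e$ at an equilibrium point $g_e$ (i.e. $g_e\in\mathcal M_{-1}$, $\mathrm{Ric}(g_e)=-\frac1n g_e$, with $p=0$), and non-static otherwise. *)

theory Defs
  imports "HOL-Analysis.Analysis"
begin

section \<open>Smooth functions on open sets of \<open>real ^ 'n\<close>\<close>

definition pd :: "'n::finite \<Rightarrow> (real^'n \<Rightarrow> 'b::real_normed_vector) \<Rightarrow> real^'n \<Rightarrow> 'b" where
  "pd i f x = frechet_derivative f (at x) (axis i 1)"

abbreviation iter_pd :: "'n::finite list \<Rightarrow> (real^'n \<Rightarrow> 'b::real_normed_vector) \<Rightarrow> real^'n \<Rightarrow> 'b" where
  "iter_pd is f \<equiv> foldr pd is f"

text \<open>Only used for open \<open>S\<close>: iterated partial derivatives of all orders exist and are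
  (totally) differentiable, hence continuous, on \<open>S\<close>.\<close>

definition smooth_on :: "(real^'n::finite) set \<Rightarrow> (real^'n \<Rightarrow> 'b::real_normed_vector) \<Rightarrow> bool" where
  "smooth_on S f \<longleftrightarrow> (\<forall>is. \<forall>x\<in>S. iter_pd is f differentiable (at x))"


section \<open>Oriented smooth manifolds\<close>

text \<open>The underlying space is the whole type \<open>'m\<close>. A chart is a pair of its domain and its
  coordinate map; the values of the coordinate map off the domain are irrelevant. The smooth
  structure and the orientation are those generated by an oriented atlas, which need not be
  maximal.\<close>

type_synonym ('m, 'n) chart = "'m set \<times> ('m \<Rightarrow> real^'n)"

abbreviation cdom :: "('m, 'n::finite) chart \<Rightarrow> 'm set" where
  "cdom c \<equiv> fst c"

abbreviation cmap :: "('m, 'n::finite) chart \<Rightarrow> 'm \<Rightarrow> real^'n" where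
  "cmap c \<equiv> snd c"

definition cimg :: "('m, 'n::finite) chart \<Rightarrow> (real^'n) set" where
  "cimg c = cmap c ` cdom c"

definition cinv :: "('m, 'n::finite) chart \<Rightarrow> real^'n \<Rightarrow> 'm" where
  "cinv c = inv_into (cdom c) (cmap c)"

definition transition :: "('m, 'n::finite) chart \<Rightarrow> ('m, 'n) chart \<Rightarrow> real^'n \<Rightarrow> real^'n" where
  "transition c c' = cmap c' \<circ> cinv c"

definition smooth_atlas :: "('m::topological_space, 'n::finite) chart set \<Rightarrow> bool" where
  "smooth_atlas A \<longleftrightarrow>
     (\<forall>c\<in>A. open (cdom c) \<and> open (cimg c) \<and> homeomorphism (cdom c) (cimg c) (cmap c) (cinv c)) \<and>
     (\<Union>c\<in>A. cdom c) = UNIV \<and>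
     (\<forall>c\<in>A. \<forall>c'\<in>A. smooth_on (cmap c ` (cdom c \<inter> cdom c')) (transition c c'))"

definition oriented_atlas :: "('m::topological_space, 'n::finite) chart set \<Rightarrow> bool" where
  "oriented_atlas A \<longleftrightarrow>
     smooth_atlas A \<and>
     (\<forall>c\<in>A. \<forall>c'\<in>A. \<forall>x \<in> cmap c ` (cdom c \<inter> cdom c').
        det (matrix (frechet_derivative (transition c c') (at x))) > 0)"

definition closed_connected_oriented_manifold ::
    "('m::{t2_space,second_countable_topology}, 'n::finite) chart set \<Rightarrow> bool" where
  "closed_connected_oriented_manifold A \<longleftrightarrow>
     oriented_atlas A \<and> compact (UNIV :: 'm set) \<and> connected (UNIV :: 'm set)"


section \<open>Tangent vectors, symmetric 2-tensor fields, metrics\<close>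

text \<open>A tangent vector at \<open>q\<close> is the family of its coordinate vectors in all charts around \<open>q\<close>,
  related by the Jacobians of the transition maps (and \<open>0\<close> at all other charts, so that tangent
  vectors are equal iff their coordinates are).\<close>

type_synonym ('m, 'n) tvec = "('m, 'n) chart \<Rightarrow> real^'n"

definition tangent_space :: "('m, 'n::finite) chart set \<Rightarrow> 'm \<Rightarrow> ('m, 'n) tvec set" where
  "tangent_space A q = {v.
     (\<forall>c\<in>A. \<forall>c'\<in>A. q \<in> cdom c \<inter> cdom c' \<longrightarrow>
        v c' = frechet_derivative (transition c c') (at (cmap c q)) (v c)) \<and>
     (\<forall>c. \<not> (c \<in> A \<and> q \<in> cdom c) \<longrightarrow> v c = 0)}"

text \<open>The coordinate vector \<open>\<partial>/\<partial>x\<^sup>i\<close> of the chart \<open>c\<close> at \<open>q\<close>.\<close>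

definition coord_vec :: "('m, 'n::finite) chart set \<Rightarrow> ('m, 'n) chart \<Rightarrow> 'm \<Rightarrow> 'n \<Rightarrow> ('m, 'n) tvec" where
  "coord_vec A c q i = (\<lambda>c'. if c' \<in> A \<and> q \<in> cdom c'
     then frechet_derivative (transition c c') (at (cmap c q)) (axis i 1) else 0)"

type_synonym ('m, 'n) tensor2 = "'m \<Rightarrow> ('m, 'n) tvec \<Rightarrow> ('m, 'n) tvec \<Rightarrow> real"

definition tcomp :: "('m, 'n::finite) chart set \<Rightarrow> ('m, 'n) tensor2 \<Rightarrow> ('m, 'n) chart \<Rightarrow> real^'n \<Rightarrow> real^'n^'n" where
  "tcomp A h c x = (\<chi> i j. h (cinv c x) (coord_vec A c (cinv c x) i) (coord_vec A c (cinv c x) j))"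

text \<open>Smooth symmetric covariant 2-tensor fields. The value \<open>0\<close> off the tangent spaces makes the
  representation of a field by a HOL function unique.\<close>

definition sym2_fields :: "('m, 'n::finite) chart set \<Rightarrow> ('m, 'n) tensor2 set" where
  "sym2_fields A = {h.
     (\<forall>q. \<forall>u \<in> tangent_space A q. \<forall>v \<in> tangent_space A q. h q u v = h q v u) \<and>
     (\<forall>q. \<forall>u \<in> tangent_space A q. \<forall>v \<in> tangent_space A q. \<forall>w \<in> tangent_space A q. \<forall>a b.
        h q (\<lambda>c. a *\<^sub>R u c + b *\<^sub>R v c) w = a * h q u w + b * h q v w) \<and>
     (\<forall>q u v. \<not> (u \<in> tangent_space A q \<and> v \<in> tangent_space A q) \<longrightarrow> h q u v = 0) \<and>
     (\<forall>c\<in>A. smooth_on (cimg c) (tcomp A h c))}"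

definition metrics :: "('m, 'n::finite) chart set \<Rightarrow> ('m, 'n) tensor2 set" where
  "metrics A = {g \<in> sym2_fields A.
     \<forall>q. \<forall>v \<in> tangent_space A q. v \<noteq> (\<lambda>_. 0) \<longrightarrow> g q v v > 0}"

definition fun_rep :: "('m \<Rightarrow> real) \<Rightarrow> ('m, 'n::finite) chart \<Rightarrow> real^'n \<Rightarrow> real" where
  "fun_rep f c = f \<circ> cinv c"

definition smooth_funs :: "('m, 'n::finite) chart set \<Rightarrow> ('m \<Rightarrow> real) set" where
  "smooth_funs A = {f. \<forall>c\<in>A. smooth_on (cimg c) (fun_rep f c)}"

definition pos_smooth_funs :: "('m, 'n::finite) chart set \<Rightarrow> ('m \<Rightarrow> real) set" where
  "pos_smooth_funs A = {f \<in> smooth_funs A. \<forall>q. f q > 0}"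


section \<open>Curvature in local coordinates\<close>

text \<open>Here \<open>G\<close> is the matrix function \<open>g\<^sub>i\<^sub>j\<close> of the components of a metric in a chart.
  \<open>riemann G l k i j\<close> is the component of \<open>\<partial>\<^sub>l\<close> in \<open>R(\<partial>\<^sub>i, \<partial>\<^sub>j) \<partial>\<^sub>k\<close>, where
  \<open>R(X, Y) = [\<nabla>\<^sub>X, \<nabla>\<^sub>Y] - \<nabla>\<^bsub>[X,Y]\<^esub>\<close>; with the contraction below, round spheres
  have positive Ricci curvature.\<close>

definition christoffel :: "(real^'n \<Rightarrow> real^'n^'n) \<Rightarrow> 'n::finite \<Rightarrow> 'n \<Rightarrow> 'n \<Rightarrow> real^'n \<Rightarrow> real" where
  "christoffel G k i j x = (1/2) * (\<Sum>l\<in>UNIV. matrix_inv (G x) $ k $ l *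
     (pd i (\<lambda>y. G y $ j $ l) x + pd j (\<lambda>y. G y $ i $ l) x - pd l (\<lambda>y. G y $ i $ j) x))"

definition riemann :: "(real^'n \<Rightarrow> real^'n^'n) \<Rightarrow> 'n::finite \<Rightarrow> 'n \<Rightarrow> 'n \<Rightarrow> 'n \<Rightarrow> real^'n \<Rightarrow> real" where
  "riemann G l k i j x =
     pd i (christoffel G l j k) x - pd j (christoffel G l i k) x +
     (\<Sum>m\<in>UNIV. christoffel G l i m x * christoffel G m j k x
              - christoffel G l j m x * christoffel G m i k x)"

definition ricci :: "(real^'n \<Rightarrow> real^'n^'n) \<Rightarrow> real^'n \<Rightarrow> real^('n::finite)^'n" where
  "ricci G x = (\<chi> k j. \<Sum>i\<in>UNIV. riemann G i k i j x)"

definition scalar_curvature :: "(real^'n::finite \<Rightarrow> real^'n^'n) \<Rightarrow> real^'n \<Rightarrow> real" where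
  "scalar_curvature G x = (\<Sum>i\<in>UNIV. \<Sum>j\<in>UNIV. matrix_inv (G x) $ i $ j * ricci G x $ i $ j)"

definition metrics_neg1 :: "('m, 'n::finite) chart set \<Rightarrow> ('m, 'n) tensor2 set" where
  "metrics_neg1 A = {g \<in> metrics A. \<forall>c\<in>A. \<forall>x\<in>cimg c. scalar_curvature (tcomp A g c) x = -1}"


section \<open>The Riemannian volume measure\<close>

text \<open>The unique Borel measure which in every chart has density \<open>sqrt (det (g\<^sub>i\<^sub>j))\<close> with respect
  to Lebesgue measure.\<close>

definition riem_volume :: "('m::topological_space, 'n::finite) chart set \<Rightarrow> ('m, 'n) tensor2 \<Rightarrow> 'm measure" where
  "riem_volume A g = (THE \<mu>. sets \<mu> = sets borel \<and>
     (\<forall>c\<in>A. \<forall>B\<in>sets borel. B \<subseteq> cdom c \<longrightarrow>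
        emeasure \<mu> B = (\<integral>\<^sup>+x \<in> cmap c ` B. ennreal (sqrt (det (tcomp A g c x))) \<partial>lborel)))"

definition vol :: "('m::topological_space, 'n::finite) chart set \<Rightarrow> 'm set \<Rightarrow> ('m, 'n) tensor2 \<Rightarrow> real" where
  "vol A D g = measure (riem_volume A g) D"


section \<open>Curves of smooth fields in the \<open>C\<^sup>\<infinity>\<close> topology\<close>

text \<open>Convergence in the \<open>C\<^sup>\<infinity>\<close> topology: in every chart, all iterated partial derivatives of
  the local representatives converge uniformly on compact sets. Fields enter through their local
  representatives (\<open>tcomp A h\<close> for tensor fields, \<open>fun_rep f\<close> for functions).\<close>

definition cinf_tendsto :: "('m, 'n::finite) chart set \<Rightarrow>
    ('x \<Rightarrow> ('m, 'n) chart \<Rightarrow> real^'n \<Rightarrow> 'b::real_normed_vector) \<Rightarrow>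
    (('m, 'n) chart \<Rightarrow> real^'n \<Rightarrow> 'b) \<Rightarrow> 'x filter \<Rightarrow> bool" where
  "cinf_tendsto A H L F \<longleftrightarrow>
     (\<forall>c\<in>A. \<forall>K is. compact K \<and> K \<subseteq> cimg c \<longrightarrow>
        uniform_limit K (\<lambda>s. iter_pd is (H s c)) (iter_pd is (L c)) F)"

definition has_cinf_deriv :: "('m, 'n::finite) chart set \<Rightarrow>
    (real \<Rightarrow> ('m, 'n) chart \<Rightarrow> real^'n \<Rightarrow> 'b::real_normed_vector) \<Rightarrow>
    (('m, 'n) chart \<Rightarrow> real^'n \<Rightarrow> 'b) \<Rightarrow> real \<Rightarrow> real set \<Rightarrow> bool" where
  "has_cinf_deriv A H H' t I \<longleftrightarrow>
     cinf_tendsto A (\<lambda>s c x. (H s c x - H t c x) /\<^sub>R (s - t)) H' (at t within I)"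

definition cinf_continuous_on :: "('m, 'n::finite) chart set \<Rightarrow>
    ('x \<Rightarrow> ('m, 'n) chart \<Rightarrow> real^'n \<Rightarrow> 'b::real_normed_vector) \<Rightarrow> real set \<Rightarrow> (real \<Rightarrow> 'x) \<Rightarrow> bool" where
  "cinf_continuous_on A rep I h \<longleftrightarrow>
     (\<forall>t\<in>I. cinf_tendsto A (\<lambda>s. rep (h s)) (rep (h t)) (at t within I))"

text \<open>Smoothness of a curve \<open>h\<close> in the Frechet space \<open>E\<close> of fields: \<open>d k\<close> is its \<open>k\<close>-th
  derivative.\<close>

definition cinf_smooth_curve_on :: "('m, 'n::finite) chart set \<Rightarrow>
    ('x \<Rightarrow> ('m, 'n) chart \<Rightarrow> real^'n \<Rightarrow> 'b::real_normed_vector) \<Rightarrow> 'x set \<Rightarrow> real set \<Rightarrow> (real \<Rightarrow> 'x) \<Rightarrow> bool" where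
  "cinf_smooth_curve_on A rep E J h \<longleftrightarrow>
     (\<exists>d :: nat \<Rightarrow> real \<Rightarrow> 'x. d 0 = h \<and>
        (\<forall>k. \<forall>t\<in>J. d k t \<in> E \<and>
           has_cinf_deriv A (\<lambda>s. rep (d k s)) (rep (d (Suc k) t)) t J))"


section \<open>Conformal Ricci flow\<close>

definition time_dom :: "ereal \<Rightarrow> real set" where
  "time_dom T = {t. 0 \<le> t \<and> ereal t < T}"

text \<open>The derivative within \<open>time_dom T\<close> is one-sided at \<open>0\<close> and two-sided elsewhere.\<close>

definition conformal_ricci_flow ::
    "('m::topological_space, 'n::finite) chart set \<Rightarrow> ereal \<Rightarrow> (real \<Rightarrow> ('m, 'n) tensor2) \<Rightarrow> (real \<Rightarrow> 'm \<Rightarrow> real) \<Rightarrow> bool" where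
  "conformal_ricci_flow A T g p \<longleftrightarrow>
     0 < T \<and>
     (\<forall>t\<in>time_dom T. g t \<in> metrics A \<and> p t \<in> smooth_funs A) \<and>
     cinf_continuous_on A (tcomp A) (time_dom T) g \<and>
     cinf_continuous_on A fun_rep (time_dom T) p \<and>
     cinf_smooth_curve_on A (tcomp A) (sym2_fields A) (time_dom T - {0}) g \<and>
     cinf_smooth_curve_on A fun_rep (smooth_funs A) (time_dom T - {0}) p \<and>
     (\<forall>t\<in>time_dom T. g t \<in> metrics_neg1 A \<and>
        (\<exists>g'. has_cinf_deriv A (\<lambda>s. tcomp A (g s)) g' t (time_dom T) \<and>
           (\<forall>c\<in>A. \<forall>x\<in>cimg c.
              g' c x + 2 *\<^sub>R (ricci (tcomp A (g t) c) x + (1 / real CARD('n)) *\<^sub>R tcomp A (g t) c x)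
              = - (p t (cinv c x) *\<^sub>R tcomp A (g t) c x))))"

definition equilibria :: "('m, 'n::finite) chart set \<Rightarrow> ('m, 'n) tensor2 set" where
  "equilibria A = {g \<in> metrics_neg1 A. \<forall>c\<in>A. \<forall>x\<in>cimg c.
     ricci (tcomp A g c) x = - ((1 / real CARD('n)) *\<^sub>R tcomp A g c x)}"

definition static_flow ::
    "('m, 'n::finite) chart set \<Rightarrow> ereal \<Rightarrow> (real \<Rightarrow> ('m, 'n) tensor2) \<Rightarrow> (real \<Rightarrow> 'm \<Rightarrow> real) \<Rightarrow> bool" where
  "static_flow A T g p \<longleftrightarrow>
     (\<exists>ge\<in>equilibria A. \<forall>t\<in>time_dom T. g t = ge \<and> p t = (\<lambda>_. 0))"

end

theory Submission
  imports Defs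
begin

text \<open>
  In a chart the volume element has the density \<open>sqrt (det G)\<close>, where \<open>G\<close> is the matrix of
  components of the metric. By Jacobi's formula its logarithmic time derivative is half of
  \<open>trace (G' ** matrix_inv G)\<close>. The flow equation says \<open>G' = - p G - 2 (Ric + G / n)\<close>, and the
  trace of \<open>Ric + G / n\<close> is the scalar curvature plus \<open>1\<close>, which vanishes because the scalar
  curvature is constantly \<open>-1\<close>. Only \<open>- n p\<close> remains: the density solves
  \<open>f' = - (n / 2) p f\<close> pointwise (\<open>vol_density_has_derivative\<close>). Integrating this over \<open>D\<close> gives the
  formula (\<open>vol_has_derivative\<close>), and its sign follows from \<open>p > 0\<close> because a nonempty open set has
  positive volume (\<open>integral_riem_volume_pos\<close>).

  Two things need work. First, the volume measure is given by a definite description, so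
  existence and uniqueness of a Borel measure with the prescribed densities have to be
  established (\<open>riem_volume_like_riem_volume\<close>). Compactness cuts the manifold into finitely many
  disjoint Borel pieces, each with compact closure in a chart; a measure is determined by its
  restrictions to the pieces, and the sum of the local measures has the right density in every
  other chart by the change of variables formula and the tensor law
  \<open>det G = (det J)\<^sup>2 det H\<close> for the component matrices \<open>G\<close> and \<open>H\<close> in two charts. Second, the derivative is taken under the integral: on a piece the
  convergence in the \<open>C\<^sup>\<infinity>\<close> topology bounds \<open>p f\<close> uniformly for times near \<open>t\<close>, so difference
  quotients are dominated by a constant.
\<close>

section \<open>Change of variables\<close>

text \<open>The change of variables theorem speaks of absolutely integrable functions. This dichotomy
  carries it over to nonnegative functions whose integral may be infinite.\<close>

lemma nn_integral_eq_integral_or_top: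
  fixes f :: "'a::euclidean_space \<Rightarrow> real"
  assumes "set_borel_measurable borel S f" and S: "S \<in> sets borel" and nn: "\<And>x. x \<in> S \<Longrightarrow> 0 \<le> f x"
  shows "(\<integral>\<^sup>+x\<in>S. ennreal (f x) \<partial>lborel)
    = (if f absolutely_integrable_on S then ennreal (integral S f) else \<infinity>)"
proof (cases "f absolutely_integrable_on S")
  case True
  then have "(f has_integral integral S f) S"
    using integrable_integral set_lebesgue_integral_eq_integral(1) by blast
  from nn_integral_has_integral_lebesgue'[OF nn this] True show ?thesis by simp
next
  case False
  have "(\<integral>\<^sup>+x\<in>S. ennreal (f x) \<partial>lborel) = \<infinity>"
  proof (rule ccontr)
    assume "(\<integral>\<^sup>+x\<in>S. ennreal (f x) \<partial>lborel) \<noteq> \<infinity>"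
    then have fin: "(\<integral>\<^sup>+x\<in>S. ennreal (f x) \<partial>lborel) < \<infinity>" by (simp add: less_top)
    have "(\<integral>\<^sup>+x\<in>S. ennreal (f x) \<partial>lborel) = (\<integral>\<^sup>+x. ennreal (norm (indicator S x *\<^sub>R f x)) \<partial>lborel)"
      by (intro nn_integral_cong) (auto simp: indicator_def nn)
    with fin have "integrable lborel (\<lambda>x. indicator S x *\<^sub>R f x)"
      using assms(1) by (intro integrableI_bounded) (auto simp: set_borel_measurable_def)
    then have "f absolutely_integrable_on S"
      unfolding set_integrable_def using integrable_completion[of "\<lambda>x. indicator S x *\<^sub>R f x" lborel]
        assms(1) by (simp add: set_borel_measurable_def)
    with False show False by simp
  qed
  with False show ?thesis by simp
qed

lemma nn_integral_change_of_variables_wellorder: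
  fixes g :: "real^'m::{finite,wellorder} \<Rightarrow> real^'m::_" and f :: "real^'m::_ \<Rightarrow> real"
  assumes S: "S \<in> sets borel" and gS: "g ` S \<in> sets borel"
    and der: "\<And>x. x \<in> S \<Longrightarrow> (g has_derivative g' x) (at x within S)"
    and inj: "inj_on g S" and nn: "\<And>y. y \<in> g ` S \<Longrightarrow> 0 \<le> f y"
    and f: "set_borel_measurable borel (g ` S) f"
    and gf: "set_borel_measurable borel S (\<lambda>x. \<bar>det (matrix (g' x))\<bar> * f (g x))"
  shows "(\<integral>\<^sup>+y\<in>g ` S. ennreal (f y) \<partial>lborel)
    = (\<integral>\<^sup>+x\<in>S. ennreal (\<bar>det (matrix (g' x))\<bar> * f (g x)) \<partial>lborel)"
proof -
  have "(\<lambda>x. \<bar>det (matrix (g' x))\<bar> *\<^sub>R (vec (f (g x)) :: real^1)) absolutely_integrable_on S \<and>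
      integral S (\<lambda>x. \<bar>det (matrix (g' x))\<bar> *\<^sub>R (vec (f (g x)) :: real^1)) = vec b \<longleftrightarrow>
      (\<lambda>y. vec (f y) :: real^1) absolutely_integrable_on (g ` S) \<and>
      integral (g ` S) (\<lambda>y. vec (f y) :: real^1) = vec b" for b
    by (rule has_absolute_integral_change_of_variables[OF _ der inj]) (use S in auto)
  then have eq: "(\<lambda>x. \<bar>det (matrix (g' x))\<bar> * f (g x)) absolutely_integrable_on S \<and>
      integral S (\<lambda>x. \<bar>det (matrix (g' x))\<bar> * f (g x)) = b \<longleftrightarrow>
      f absolutely_integrable_on (g ` S) \<and> integral (g ` S) f = b" for b
    by (simp add: absolutely_integrable_on_1_iff integral_on_1_eq)
  have iff: "f absolutely_integrable_on g ` S
      \<longleftrightarrow> (\<lambda>x. \<bar>det (matrix (g' x))\<bar> * f (g x)) absolutely_integrable_on S"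
    using eq by blast
  have same: "integral S (\<lambda>x. \<bar>det (matrix (g' x))\<bar> * f (g x)) = integral (g ` S) f"
    if "f absolutely_integrable_on g ` S"
    using eq[of "integral (g ` S) f"] that by blast
  have "(\<integral>\<^sup>+y\<in>g ` S. ennreal (f y) \<partial>lborel)
      = (if f absolutely_integrable_on g ` S then ennreal (integral (g ` S) f) else \<infinity>)"
    by (rule nn_integral_eq_integral_or_top[OF f gS]) (rule nn)
  moreover have "(\<integral>\<^sup>+x\<in>S. ennreal (\<bar>det (matrix (g' x))\<bar> * f (g x)) \<partial>lborel)
      = (if (\<lambda>x. \<bar>det (matrix (g' x))\<bar> * f (g x)) absolutely_integrable_on S
         then ennreal (integral S (\<lambda>x. \<bar>det (matrix (g' x))\<bar> * f (g x))) else \<infinity>)"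
    by (rule nn_integral_eq_integral_or_top[OF gf S]) (simp add: nn)
  ultimately show ?thesis
    using iff same by (cases "f absolutely_integrable_on g ` S") simp_all
qed

text \<open>The coordinates of a chart are indexed by an arbitrary finite type, whereas
  \<open>nn_integral_change_of_variables_wellorder\<close> needs a well-ordered index type. The type
  \<open>'a idx\<close> is a well-ordered copy of \<open>'a\<close>; renaming coordinates along a bijection preserves
  Lebesgue measure and determinants.\<close>

typedef ('a::finite) idx = "{..<CARD('a)}"
  by (rule exI[of _ 0]) simp

instantiation idx :: (finite) linorder
begin

definition "i \<le> j \<longleftrightarrow> Rep_idx i \<le> Rep_idx j"
definition "i < j \<longleftrightarrow> Rep_idx i < Rep_idx j"

instance
  by intro_classes (auto simp: less_eq_idx_def less_idx_def Rep_idx_inject)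

end

lemma UNIV_idx: "(UNIV :: 'a::finite idx set) = Abs_idx ` {..<CARD('a)}"
  by (metis Abs_idx_cases UNIV_eq_I image_eqI)

lemma card_idx: "CARD('a::finite idx) = CARD('a)"
  by (subst UNIV_idx, subst card_image) (auto simp: inj_on_def Abs_idx_inject)

instance idx :: (finite) finite
proof
  show "finite (UNIV :: 'a idx set)"
    by (subst UNIV_idx) (rule finite_imageI, simp)
qed

instance idx :: (finite) wellorder
proof
  fix P :: "'a idx \<Rightarrow> bool" and i
  assume step: "\<And>i. (\<And>j. j < i \<Longrightarrow> P j) \<Longrightarrow> P i"
  show "P i"
    proof (induction i rule: measure_induct_rule[of Rep_idx])
    case (less i)
    then show ?case
      by (rule step) (simp add: less_idx_def)
  qed
qed

definition reindex :: "('m \<Rightarrow> 'n) \<Rightarrow> 'a^'n::finite \<Rightarrow> 'a^'m::finite" where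
  "reindex \<pi> x = (\<chi> i. x $ \<pi> i)"

lemma reindex_nth [simp]: "reindex \<pi> x $ i = x $ \<pi> i"
  by (simp add: reindex_def)

lemma bounded_linear_reindex: "bounded_linear (reindex \<pi> :: real^'n::finite \<Rightarrow> real^'m::finite)"
  by (intro linear_conv_bounded_linear[THEN iffD1] linearI) (auto simp: vec_eq_iff)

lemma reindex_inverse:
  assumes "bij \<pi>"
  shows "reindex \<pi> (reindex (inv \<pi>) x) = x" "reindex (inv \<pi>) (reindex \<pi> y) = y"
  using assms by (auto simp: vec_eq_iff bij_def inv_f_f surj_f_inv_f)

lemma reindex_measurable [measurable]:
  "(reindex \<pi> :: real^'n::finite \<Rightarrow> real^'m::finite) \<in> borel_measurable borel"
  by (intro borel_measurable_continuous_onI linear_continuous_on bounded_linear_reindex)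

lemma prod_Basis_cart: "(\<Prod>b\<in>(Basis :: (real^'n::finite) set). F (x \<bullet> b)) = (\<Prod>i\<in>UNIV. F (x $ i) :: real)"
proof -
  have "bij_betw (\<lambda>i. axis i 1 :: real^'n) UNIV Basis"
    by (auto simp: bij_betw_def inj_on_def axis_eq_axis Basis_vec_def)
  from prod.reindex_bij_betw[OF this, of "\<lambda>b. F (x \<bullet> b)"]
  have "(\<Prod>b\<in>(Basis :: (real^'n) set). F (x \<bullet> b)) = (\<Prod>i\<in>UNIV. F (x \<bullet> axis i 1))" ..
  then show ?thesis
    by (simp add: inner_axis)
qed

lemma lborel_reindex:
  assumes \<pi>: "bij (\<pi> :: 'm::finite \<Rightarrow> 'n::finite)"
  shows "distr lborel borel (reindex \<pi>) = (lborel :: (real^'m) measure)"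
proof (rule lborel_eqI[symmetric])
  fix l u :: "real^'m"
  assume "\<And>b. b \<in> Basis \<Longrightarrow> l \<bullet> b \<le> u \<bullet> b"
  then have le: "l $ i \<le> u $ i" for i
    by (metis axis_in_Basis_iff cart_eq_inner_axis Basis_real_def insertI1)
  have vim: "reindex \<pi> -` box l u = box (reindex (inv \<pi>) l) (reindex (inv \<pi>) u)"
  proof (intro set_eqI)
    fix x :: "real^'n"
    have all: "(\<forall>k. P k) \<longleftrightarrow> (\<forall>i. P (\<pi> i))" for P
      by (metis \<pi> bij_pointE)
    have "x \<in> box (reindex (inv \<pi>) l) (reindex (inv \<pi>) u)
        \<longleftrightarrow> (\<forall>i. l $ i < x $ \<pi> i \<and> x $ \<pi> i < u $ i)"
      by (simp add: mem_box_cart all inv_f_f[OF bij_is_inj[OF \<pi>]])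
    then show "x \<in> reindex \<pi> -` box l u \<longleftrightarrow> x \<in> box (reindex (inv \<pi>) l) (reindex (inv \<pi>) u)"
      by (simp add: mem_box_cart)
  qed
  have "emeasure (distr lborel borel (reindex \<pi>)) (box l u)
      = emeasure lborel (box (reindex (inv \<pi>) l) (reindex (inv \<pi>) u))"
    by (subst emeasure_distr) (auto simp: vim)
  also have "\<dots> = (\<Prod>b\<in>Basis. (reindex (inv \<pi>) u - reindex (inv \<pi>) l) \<bullet> b)"
    by (rule emeasure_lborel_box) (auto simp: Basis_vec_def inner_axis le)
  also have "\<dots> = ennreal (\<Prod>k\<in>UNIV. (u - l) $ inv \<pi> k)"
    by (simp add: prod_Basis_cart[where F="\<lambda>x. x"])
  also have "(\<Prod>k\<in>UNIV. (u - l) $ inv \<pi> k) = (\<Prod>i\<in>UNIV. (u - l) $ i)"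
    by (rule prod.reindex_bij_betw) (simp add: \<pi> bij_imp_bij_inv)
  finally show "emeasure (distr lborel borel (reindex \<pi>)) (box l u) = (\<Prod>b\<in>Basis. (u - l) \<bullet> b)"
    by (simp add: prod_Basis_cart[where F="\<lambda>x. x"])
qed simp

text \<open>Conjugation by the bijection matches the permutations of the two index types and preserves
  signs, so the Leibniz sums agree term by term.\<close>

lemma det_reindex:
  fixes A :: "'a::comm_ring_1^'n^'n::finite"
  assumes \<pi>: "bij (\<pi> :: 'm::finite \<Rightarrow> 'n)"
  shows "det (\<chi> i j. A $ \<pi> i $ \<pi> j) = det A"
proof -
  have inj: "inj \<pi>" and bb: "bij_betw \<pi> UNIV UNIV"
    using \<pi> by (auto simp: bij_def)
  let ?F = "map_permutation (UNIV :: 'm set) \<pi>"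
  have eq: "?F p = \<pi> \<circ> p \<circ> inv \<pi>" for p
    using \<pi> by (auto simp: map_permutation_def restrict_id_def bij_def fun_eq_iff)
  have bij: "bij_betw ?F {p. p permutes UNIV} {p. p permutes UNIV}"
  proof (rule bij_betwI[where g="\<lambda>q. inv \<pi> \<circ> q \<circ> \<pi>"])
    show "?F \<in> {p. p permutes UNIV} \<rightarrow> {p. p permutes UNIV}"
      using map_permutation_permutes[OF bb] by auto
    show "(\<lambda>q. inv \<pi> \<circ> q \<circ> \<pi>) \<in> {p. p permutes UNIV} \<rightarrow> {p. p permutes UNIV}"
    proof
      fix q :: "'n \<Rightarrow> 'n" assume "q \<in> {p. p permutes UNIV}"
      then have "bij (inv \<pi> \<circ> (q \<circ> \<pi>))"
        by (intro bij_comp \<pi> bij_imp_bij_inv) (simp add: permutes_bij)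
      then show "inv \<pi> \<circ> q \<circ> \<pi> \<in> {p. p permutes UNIV}"
        by (auto intro: bij_imp_permutes simp: o_assoc)
    qed
    show "inv \<pi> \<circ> ?F p \<circ> \<pi> = p" for p
      by (simp add: eq fun_eq_iff inv_f_f[OF inj])
    show "?F (inv \<pi> \<circ> q \<circ> \<pi>) = q" for q
      using \<pi> by (simp add: eq fun_eq_iff bij_def surj_f_inv_f)
  qed
  have "det A = (\<Sum>q | q permutes UNIV. of_int (sign q) * (\<Prod>k\<in>UNIV. A $ k $ q k))"
    by (simp add: det_def)
  also have "\<dots> = (\<Sum>p | p permutes (UNIV::'m set). of_int (sign (?F p)) * (\<Prod>k\<in>UNIV. A $ k $ ?F p k))"
    by (rule sum.reindex_bij_betw[OF bij, symmetric])
  also have "\<dots> = (\<Sum>p | p permutes (UNIV::'m set). of_int (sign p) * (\<Prod>i\<in>UNIV. A $ \<pi> i $ \<pi> (p i)))"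
  proof (intro sum.cong refl)
    fix p assume "p \<in> {p. p permutes (UNIV::'m set)}"
    then have "sign (?F p) = sign p"
      by (intro sign_map_permutation) (auto simp: inj)
    moreover have "(\<Prod>k\<in>UNIV. A $ k $ ?F p k) = (\<Prod>i\<in>UNIV. A $ \<pi> i $ ?F p (\<pi> i))"
      by (rule prod.reindex_bij_betw[OF bb, symmetric])
    ultimately show "of_int (sign (?F p)) * (\<Prod>k\<in>UNIV. A $ k $ ?F p k)
        = of_int (sign p) * (\<Prod>i\<in>UNIV. A $ \<pi> i $ \<pi> (p i))"
      by (simp add: eq inv_f_f[OF inj])
  qed
  also have "\<dots> = det (\<chi> i j. A $ \<pi> i $ \<pi> j)"
    by (simp add: det_def)
  finally show ?thesis ..
qed

lemma nn_integral_change_of_variables: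
  fixes g :: "real^'n::finite \<Rightarrow> real^'n" and f :: "real^'n \<Rightarrow> real"
  assumes S: "S \<in> sets borel" and gS: "g ` S \<in> sets borel"
    and der: "\<And>x. x \<in> S \<Longrightarrow> (g has_derivative g' x) (at x within S)"
    and inj: "inj_on g S" and nn: "\<And>y. y \<in> g ` S \<Longrightarrow> 0 \<le> f y"
    and f: "set_borel_measurable borel (g ` S) f"
    and gf: "set_borel_measurable borel S (\<lambda>x. \<bar>det (matrix (g' x))\<bar> * f (g x))"
  shows "(\<integral>\<^sup>+y\<in>g ` S. ennreal (f y) \<partial>lborel)
    = (\<integral>\<^sup>+x\<in>S. ennreal (\<bar>det (matrix (g' x))\<bar> * f (g x)) \<partial>lborel)"
proof -
  obtain \<pi> :: "'n idx \<Rightarrow> 'n" where \<pi>: "bij \<pi>"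
    using finite_same_card_bij[of "UNIV :: 'n idx set" "UNIV :: 'n set"] by (auto simp: card_idx)
  define R where "R = (reindex \<pi> :: real^'n \<Rightarrow> real^'n idx)"
  define R' where "R' = (reindex (inv \<pi>) :: real^'n idx \<Rightarrow> real^'n)"
  have RR': "R (R' y) = y" and R'R: "R' (R x) = x" for x y
    using reindex_inverse[OF \<pi>] by (auto simp: R_def R'_def)
  have [measurable]: "R \<in> borel_measurable borel" "R' \<in> borel_measurable borel"
    by (auto simp: R_def R'_def)
  have blR: "bounded_linear R" and blR': "bounded_linear R'"
    by (auto simp: R_def R'_def bounded_linear_reindex)
  have image: "R ` X = R' -` X" for X
    by (auto simp: RR' R'R image_iff) (metis RR')
  have lb: "distr lborel borel R' = lborel"
    unfolding R'_def by (rule lborel_reindex) (simp add: \<pi> bij_imp_bij_inv)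
  define h where "h = (\<lambda>y. R (g (R' y)))"
  define h' where "h' = (\<lambda>y v. R (g' (R' y) (R' v)))"
  have him: "h ` (R ` S) = R ` (g ` S)"
    by (auto simp: h_def image_image R'R)
  have transfer: "(\<integral>\<^sup>+x\<in>X. ennreal (u x) \<partial>lborel) = (\<integral>\<^sup>+y\<in>R ` X. ennreal (u (R' y)) \<partial>lborel)"
    if "set_borel_measurable borel X u" "X \<in> sets borel" for X and u :: "real^'n \<Rightarrow> real"
  proof -
    have [measurable]: "(\<lambda>x. indicator X x * u x) \<in> borel_measurable borel"
      using that by (simp add: set_borel_measurable_def)
    have "(\<integral>\<^sup>+x\<in>X. ennreal (u x) \<partial>lborel) = (\<integral>\<^sup>+x. ennreal (indicator X x * u x) \<partial>distr lborel borel R')"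
      unfolding lb by (intro nn_integral_cong) (auto simp: indicator_def)
    also have "\<dots> = (\<integral>\<^sup>+y. ennreal (indicator X (R' y) * u (R' y)) \<partial>lborel)"
      by (subst nn_integral_distr) auto
    also have "\<dots> = (\<integral>\<^sup>+y\<in>R ` X. ennreal (u (R' y)) \<partial>lborel)"
      unfolding image by (intro nn_integral_cong) (auto simp: indicator_def)
    finally show ?thesis .
  qed
  have meas: "set_borel_measurable borel (R ` X) (\<lambda>y. u (R' y))"
    if "set_borel_measurable borel X u" for X and u :: "real^'n \<Rightarrow> real"
  proof -
    have [measurable]: "(\<lambda>x. indicator X x *\<^sub>R u x) \<in> borel_measurable borel"
      using that by (simp add: set_borel_measurable_def)
    have "(\<lambda>y. indicator X (R' y) *\<^sub>R u (R' y)) \<in> borel_measurable borel"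
      by measurable
    then show ?thesis
      by (simp add: set_borel_measurable_def image indicator_def)
  qed
  have sets: "R ` X \<in> sets borel" if "X \<in> sets borel" for X
    using measurable_sets_borel[OF \<open>R' \<in> borel_measurable borel\<close> that] by (simp add: image)
  have det: "det (matrix (h' y)) = det (matrix (g' (R' y)))" for y
  proof -
    have "R' (axis j 1) = axis (\<pi> j) 1" for j
      using \<pi> by (auto simp: R'_def vec_eq_iff axis_def bij_def inv_f_f surj_f_inv_f)
    then have "matrix (h' y) = (\<chi> i j. matrix (g' (R' y)) $ \<pi> i $ \<pi> j)"
      by (simp add: matrix_def h'_def R_def)
    then show ?thesis
      by (simp add: det_reindex[OF \<pi>])
  qed
  have "(\<integral>\<^sup>+y\<in>g ` S. ennreal (f y) \<partial>lborel) = (\<integral>\<^sup>+y\<in>h ` (R ` S). ennreal (f (R' y)) \<partial>lborel)"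
    unfolding him by (rule transfer[OF f gS])
  also have "\<dots> = (\<integral>\<^sup>+y\<in>R ` S. ennreal (\<bar>det (matrix (h' y))\<bar> * f (R' (h y))) \<partial>lborel)"
  proof (rule nn_integral_change_of_variables_wellorder)
    show "(h has_derivative h' y) (at y within R ` S)" if "y \<in> R ` S" for y
    proof -
      from that have y: "R' y \<in> S" by (auto simp: R'R)
      have "(g has_derivative g' (R' y)) (at (R' y) within R' ` (R ` S))"
        using der[OF y] by (simp add: image_image R'R)
      moreover have "(R' has_derivative R') (at y within R ` S)"
        using blR' by (rule bounded_linear.has_derivative) (rule has_derivative_ident)
      ultimately have "(g \<circ> R' has_derivative g' (R' y) \<circ> R') (at y within R ` S)"
        by (intro diff_chain_within) 
      from bounded_linear.has_derivative[OF blR this] show ?thesis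
        by (simp add: h_def h'_def o_def)
    qed
    show "inj_on h (R ` S)"
      using inj by (auto simp: inj_on_def h_def R'R) (metis R'R)
    show "set_borel_measurable borel (R ` S) (\<lambda>y. \<bar>det (matrix (h' y))\<bar> * f (R' (h y)))"
      using meas[OF gf] by (simp add: det h_def R'R)
    show "set_borel_measurable borel (h ` R ` S) (\<lambda>y. f (R' y))"
      unfolding him by (rule meas[OF f])
  qed (use S gS nn him in \<open>auto simp: sets R'R\<close>)
  also have "\<dots> = (\<integral>\<^sup>+x\<in>S. ennreal (\<bar>det (matrix (g' x))\<bar> * f (g x)) \<partial>lborel)"
    unfolding transfer[OF gf S] by (simp add: det h_def R'R)
  finally show ?thesis .
qed

section \<open>Determinants\<close>

lemma matrix_inv_inverse:
  fixes A :: "real^'n::finite^'n"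
  assumes "invertible A"
  shows "A ** matrix_inv A = mat 1" "matrix_inv A ** A = mat 1"
  using someI_ex[OF assms[unfolded invertible_def]] by (auto simp: matrix_inv_def)

text \<open>Jacobi's formula. Differentiating the Leibniz sum replaces one row of \<open>G\<close> at a time by the
  corresponding row of \<open>G'\<close>. Writing \<open>G' = M ** G\<close>, that row is a combination of the rows of \<open>G\<close>
  with coefficients from \<open>M\<close>, and Cramer's rule reduces the determinant to the diagonal entry
  of \<open>M\<close> times \<open>det G\<close>.\<close>

lemma det_has_real_derivative:
  fixes G :: "real \<Rightarrow> real^'n::finite^'n"
  assumes G: "(G has_vector_derivative G') (at t within I)" and inv: "invertible (G t)"
  shows "((\<lambda>s. det (G s)) has_real_derivative det (G t) * trace (G' ** matrix_inv (G t))) (at t within I)"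
proof -
  have entry: "((\<lambda>s. G s $ i $ j) has_real_derivative G' $ i $ j) (at t within I)" for i j
  proof -
    have "bounded_linear (\<lambda>A :: real^'n^'n. A $ i $ j)"
      by (rule bounded_linear_compose[of "\<lambda>v. v $ j" "\<lambda>A. A $ i"]) (rule bounded_linear_vec_nth)+
    from bounded_linear.has_vector_derivative[OF this G] show ?thesis
      by (simp add: has_real_derivative_iff_has_vector_derivative)
  qed
  define M where "M = G' ** matrix_inv (G t)"
  have MG: "M ** G t = G'"
    by (simp add: M_def matrix_inv_inverse(2)[OF inv] flip: matrix_mul_assoc)
  \<comment> \<open>The matrix \<open>G t\<close> with its row \<open>i\<close> replaced by that of \<open>G'\<close>.\<close>
  let ?row = "\<lambda>i. (\<chi> k. if k = i then G' $ i else G t $ k) :: real^'n^'n"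
  have prod: "((\<lambda>s. \<Prod>i\<in>UNIV. G s $ i $ p i) has_real_derivative
      (\<Sum>i\<in>UNIV. G' $ i $ p i * (\<Prod>j\<in>UNIV - {i}. G t $ j $ p j))) (at t within I)" for p
  proof -
    have eq: "(*) (\<Sum>i\<in>UNIV. G' $ i $ p i * (\<Prod>j\<in>UNIV - {i}. G t $ j $ p j))
        = (\<lambda>y. \<Sum>i\<in>UNIV. (G' $ i $ p i * y) * (\<Prod>j\<in>UNIV - {i}. G t $ j $ p j))"
      by (simp add: fun_eq_iff sum_distrib_left ac_simps)
    show ?thesis
      unfolding has_field_derivative_def eq
      by (rule has_derivative_prod) (rule entry[unfolded has_field_derivative_def])
  qed
  have "((\<lambda>s. det (G s)) has_real_derivative
      (\<Sum>p | p permutes UNIV. of_int (sign p) *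
        (\<Sum>i\<in>UNIV. G' $ i $ p i * (\<Prod>j\<in>UNIV - {i}. G t $ j $ p j)))) (at t within I)"
    unfolding det_def by (intro DERIV_sum DERIV_cmult prod)
  also have "(\<Sum>p | p permutes UNIV. of_int (sign p) *
        (\<Sum>i\<in>UNIV. G' $ i $ p i * (\<Prod>j\<in>UNIV - {i}. G t $ j $ p j))) = (\<Sum>i\<in>UNIV. det (?row i))"
  proof -
    have "(\<Prod>k\<in>UNIV. ?row i $ k $ p k) = G' $ i $ p i * (\<Prod>j\<in>UNIV - {i}. G t $ j $ p j)" for i p
      by (subst prod.remove[of _ i]) auto
    then show ?thesis
      unfolding det_def sum_distrib_left by (subst sum.swap) simp
  qed
  also have "\<dots> = (\<Sum>i\<in>UNIV. M $ i $ i * det (G t))"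
  proof (intro sum.cong refl)
    fix i
    have "G' $ i = (\<Sum>k\<in>UNIV. M $ i $ k *s row k (G t))"
      unfolding MG[symmetric] by (simp add: vec_eq_iff matrix_matrix_mult_def row_def)
    then have "?row i = (\<chi> j. if j = i then \<Sum>k\<in>UNIV. M $ i $ k *s row k (G t) else row j (G t))"
      by (auto simp: vec_eq_iff row_def)
    then show "det (?row i) = M $ i $ i * det (G t)"
      by (simp only: cramer_lemma_transpose)
  qed
  also have "\<dots> = det (G t) * trace M"
    by (simp add: trace_def sum_distrib_left mult.commute)
  finally show ?thesis
    by (simp add: M_def)
qed

lemma continuous_on_det:
  fixes F :: "'a::topological_space \<Rightarrow> real^'n::finite^'n"
  assumes "continuous_on S F"
  shows "continuous_on S (\<lambda>x. det (F x))"
  unfolding det_def using assms by (intro continuous_intros)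

text \<open>The segment from the identity to \<open>A\<close> consists of positive definite, hence invertible
  matrices, so the determinant keeps the sign that it has at the identity.\<close>

lemma det_pos_if_pos_def:
  fixes A :: "real^'n::finite^'n"
  assumes pos: "\<And>v. v \<noteq> 0 \<Longrightarrow> v \<bullet> (A *v v) > 0"
  shows "det A > 0"
proof (rule ccontr)
  assume "\<not> det A > 0"
  define B where "B s = (1 - s) *\<^sub>R mat 1 + s *\<^sub>R A" for s
  have Bv: "B s *v v = (1 - s) *\<^sub>R v + s *\<^sub>R (A *v v)" for s v
    by (simp add: B_def matrix_vector_mult_add_rdistrib scaleR_matrix_vector_assoc[symmetric])
  have "continuous_on {0..1} (\<lambda>s. det (B s))"
    unfolding B_def by (intro continuous_on_det continuous_intros)
  moreover have "det (B 0) = 1" "det (B 1) = det A"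
    by (simp_all add: B_def)
  ultimately obtain s where s: "0 \<le> s" "s \<le> 1" "det (B s) = 0"
    using IVT2'[of "\<lambda>s. det (B s)" 1 0 0] \<open>\<not> det A > 0\<close> by auto
  then have "\<not> invertible (B s)"
    by (simp add: invertible_det_nz)
  then obtain v where "v \<noteq> 0" "B s *v v = 0"
    using matrix_left_invertible_ker[of "B s"] invertible_left_inverse[of "B s"] by auto
  then have "0 = v \<bullet> ((1 - s) *\<^sub>R v + s *\<^sub>R (A *v v))"
    by (simp add: Bv)
  also have "\<dots> = (1 - s) * (v \<bullet> v) + s * (v \<bullet> (A *v v))"
    by (simp add: inner_add_right)
  also have "\<dots> > 0"
  proof (cases "s = 0")
    case False
    then have "s * (v \<bullet> (A *v v)) > 0" "(1 - s) * (v \<bullet> v) \<ge> 0"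
      using s pos[OF \<open>v \<noteq> 0\<close>] by auto
    then show ?thesis by linarith
  qed (use \<open>v \<noteq> 0\<close> in simp)
  finally show False by simp
qed

lemma matrix_inv_symmetric:
  fixes A :: "real^'n::finite^'n"
  assumes "invertible A" "transpose A = A"
  shows "transpose (matrix_inv A) = matrix_inv A"
proof -
  have "transpose (matrix_inv A) ** A = mat 1"
    by (metis assms matrix_inv_inverse(1) matrix_transpose_mul transpose_mat)
  then show ?thesis
    by (metis assms(1) matrix_inv_inverse(1) matrix_mul_assoc matrix_mul_lid matrix_mul_rid)
qed

section \<open>Charts\<close>

lemma smooth_on_imp_differentiable:
  assumes "smooth_on S f" "x \<in> S"
  shows "f differentiable (at x)"
  using assms by (auto simp: smooth_on_def dest: spec[of _ "[]"])

lemma smooth_on_imp_continuous_on: "smooth_on S f \<Longrightarrow> continuous_on S f"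
  by (meson continuous_at_imp_continuous_on differentiable_imp_continuous_within smooth_on_imp_differentiable)

lemma chart_homeomorphism:
  assumes "smooth_atlas A" "c \<in> A"
  shows "open (cdom c)" "open (cimg c)" "homeomorphism (cdom c) (cimg c) (cmap c) (cinv c)"
  using assms by (auto simp: smooth_atlas_def)

lemma chart_inverse:
  assumes "smooth_atlas A" "c \<in> A"
  shows "q \<in> cdom c \<Longrightarrow> cmap c q \<in> cimg c"
    and "x \<in> cimg c \<Longrightarrow> cinv c x \<in> cdom c"
    and "q \<in> cdom c \<Longrightarrow> cinv c (cmap c q) = q"
    and "x \<in> cimg c \<Longrightarrow> cmap c (cinv c x) = x"
  using chart_homeomorphism(3)[OF assms] by (auto simp: homeomorphism_def)

lemma chart_image_eq_vimage:
  assumes "smooth_atlas A" "c \<in> A" "B \<subseteq> cdom c"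
  shows "cmap c ` B = cimg c \<inter> cinv c -` B"
  using chart_inverse[OF assms(1,2)] assms(3) by (force simp: image_iff)

lemma open_chart_image:
  assumes "smooth_atlas A" "c \<in> A" "B \<subseteq> cdom c" "open B"
  shows "open (cmap c ` B)"
  unfolding chart_image_eq_vimage[OF assms(1-3)]
  using chart_homeomorphism[OF assms(1,2)] assms(4)
  by (intro continuous_open_preimage) (auto simp: homeomorphism_def)

lemma atlas_cover:
  assumes "smooth_atlas A"
  obtains c where "c \<in> A" "q \<in> cdom c"
proof -
  have "q \<in> (\<Union>c\<in>A. cdom c)"
    using assms by (simp add: smooth_atlas_def)
  then show thesis
    using that by blast
qed

text \<open>The Jacobian of the transition from \<open>c\<close> to \<open>c'\<close>, as a linear map and at a point of the
  manifold rather than at its coordinates.\<close>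

abbreviation jac :: "('m, 'n::finite) chart \<Rightarrow> ('m, 'n) chart \<Rightarrow> 'm \<Rightarrow> real^'n \<Rightarrow> real^'n" where
  "jac c c' q \<equiv> frechet_derivative (transition c c') (at (cmap c q))"

lemma transition_has_derivative:
  assumes "smooth_atlas A" "c \<in> A" "c' \<in> A" "q \<in> cdom c" "q \<in> cdom c'"
  shows "(transition c c' has_derivative jac c c' q) (at (cmap c q))"
proof -
  have "smooth_on (cmap c ` (cdom c \<inter> cdom c')) (transition c c')"
    using assms by (auto simp: smooth_atlas_def)
  then show ?thesis
    using assms by (intro frechet_derivative_works[THEN iffD1] smooth_on_imp_differentiable) auto
qed

lemma transition_chart:
  assumes "smooth_atlas A" "c \<in> A" "q \<in> cdom c"
  shows "transition c c' (cmap c q) = cmap c' q"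
  by (simp add: transition_def chart_inverse[OF assms(1,2)] assms)

lemma jac_cocycle:
  assumes A: "smooth_atlas A" and c: "c \<in> A" "c' \<in> A" "c'' \<in> A"
    and q: "q \<in> cdom c" "q \<in> cdom c'" "q \<in> cdom c''"
  shows "jac c c'' q v = jac c' c'' q (jac c c' q v)"
proof -
  let ?W = "cdom c \<inter> cdom c' \<inter> cdom c''"
  have "(transition c' c'' \<circ> transition c c' has_derivative jac c' c'' q \<circ> jac c c' q) (at (cmap c q))"
    using transition_has_derivative[OF A c(1,2) q(1,2)] transition_has_derivative[OF A c(2,3) q(2,3)]
    by (intro diff_chain_at) (simp_all add: transition_chart[OF A c(1) q(1)])
  moreover have "open (cmap c ` ?W)"
    by (intro open_chart_image[OF A c(1)] open_Int chart_homeomorphism(1)[OF A] c) auto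
  moreover have "(transition c' c'' \<circ> transition c c') x = transition c c'' x" if "x \<in> cmap c ` ?W" for x
    using that by (auto simp: transition_chart[OF A c(1)] transition_chart[OF A c(2)])
  ultimately have "(transition c c'' has_derivative jac c' c'' q \<circ> jac c c' q) (at (cmap c q))"
    using q by (elim has_derivative_transform_within_open) auto
  then have "jac c c'' q = jac c' c'' q \<circ> jac c c' q"
    by (rule frechet_derivative_at[symmetric])
  then show ?thesis by simp
qed

lemma jac_self:
  assumes A: "smooth_atlas A" and c: "c \<in> A" and q: "q \<in> cdom c"
  shows "jac c c q v = v"
proof -
  have "(transition c c has_derivative (\<lambda>v. v)) (at (cmap c q))"
    using chart_homeomorphism(2)[OF A c] q
    by (intro has_derivative_transform_within_open[OF has_derivative_ident, of "cimg c"])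
       (auto simp: transition_def chart_inverse[OF A c])
  from frechet_derivative_at[OF this] show ?thesis by metis
qed

section \<open>The components of a metric\<close>

text \<open>The tangent vector at \<open>q\<close> whose coordinate vector in the chart \<open>c\<close> is \<open>v\<close>. It extends the
  coordinate vector fields linearly, so that a tensor can be evaluated without sums over bases.\<close>

definition chart_vec :: "('m, 'n::finite) chart set \<Rightarrow> ('m, 'n) chart \<Rightarrow> 'm \<Rightarrow> real^'n \<Rightarrow> ('m, 'n) tvec" where
  "chart_vec A c q v = (\<lambda>c'. if c' \<in> A \<and> q \<in> cdom c' then jac c c' q v else 0)"

lemma coord_vec_eq_chart_vec: "coord_vec A c q i = chart_vec A c q (axis i 1)"
  by (simp add: coord_vec_def chart_vec_def)

lemma chart_vec_in_tangent_space:
  assumes "smooth_atlas A" "c \<in> A" "q \<in> cdom c"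
  shows "chart_vec A c q v \<in> tangent_space A q"
  using assms by (auto simp: tangent_space_def chart_vec_def intro: jac_cocycle)

lemma chart_vec_chart_change:
  assumes "smooth_atlas A" "c \<in> A" "c' \<in> A" "q \<in> cdom c" "q \<in> cdom c'"
  shows "chart_vec A c q v = chart_vec A c' q (jac c c' q v)"
  unfolding chart_vec_def by (rule ext) (simp add: jac_cocycle[OF assms(1-3) _ assms(4,5)])

lemma chart_vec_lincomb:
  assumes "smooth_atlas A" "c \<in> A" "q \<in> cdom c"
  shows "chart_vec A c q (a *\<^sub>R u + b *\<^sub>R v)
    = (\<lambda>c'. a *\<^sub>R chart_vec A c q u c' + b *\<^sub>R chart_vec A c q v c')"
proof (rule ext)
  fix c'
  show "chart_vec A c q (a *\<^sub>R u + b *\<^sub>R v) c' = a *\<^sub>R chart_vec A c q u c' + b *\<^sub>R chart_vec A c q v c'"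
  proof (cases "c' \<in> A \<and> q \<in> cdom c'")
    case True
    with assms have "linear (jac c c' q)"
      using transition_has_derivative has_derivative_linear by blast
    then show ?thesis
      by (simp add: chart_vec_def linear_add linear_scale)
  qed (auto simp: chart_vec_def)
qed

lemma sym2_fields_eq_tcomp:
  assumes A: "smooth_atlas A" and c: "c \<in> A" and q: "q \<in> cdom c" and h: "h \<in> sym2_fields A"
  shows "h q (chart_vec A c q u) (chart_vec A c q v) = u \<bullet> (tcomp A h c (cmap c q) *v v)"
proof -
  let ?v = "chart_vec A c q"
  have T: "?v u \<in> tangent_space A q" for u
    by (rule chart_vec_in_tangent_space[OF A c q])
  have sym: "h q (?v u) (?v w) = h q (?v w) (?v u)" for u w
    using h T by (auto simp: sym2_fields_def)
  have lin: "h q (?v (a *\<^sub>R u + b *\<^sub>R v)) (?v w) = a * h q (?v u) (?v w) + b * h q (?v v) (?v w)" for a b u v w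
    using h T unfolding chart_vec_lincomb[OF A c q] by (auto simp: sym2_fields_def)
  have linear: "linear (\<lambda>u. h q (?v u) (?v w))" for w
    using lin[of 1 _ 1] lin[of _ _ 0 0] by (intro linearI) simp_all
  have expand: "h q (?v u) (?v w) = (\<Sum>i\<in>UNIV. u $ i * h q (?v (axis i 1)) (?v w))" for u w
  proof -
    have "h q (?v u) (?v w) = h q (?v (\<Sum>i\<in>UNIV. u $ i *\<^sub>R axis i 1)) (?v w)"
      using basis_expansion[of u] by (simp add: scalar_mult_eq_scaleR)
    then show ?thesis
      by (simp add: linear_sum[OF linear] linear_scale[OF linear])
  qed
  have "h q (?v u) (?v v) = (\<Sum>i\<in>UNIV. u $ i * (\<Sum>j\<in>UNIV. v $ j * h q (?v (axis i 1)) (?v (axis j 1))))"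
    by (subst expand, subst sym, subst expand) (simp add: sym)
  also have "\<dots> = u \<bullet> (tcomp A h c (cmap c q) *v v)"
    by (simp add: inner_vec_def matrix_vector_mult_def tcomp_def coord_vec_eq_chart_vec
        chart_inverse[OF A c] q mult.commute)
  finally show ?thesis .
qed

lemma tcomp_chart_change:
  assumes A: "smooth_atlas A" and c: "c \<in> A" "c' \<in> A" and q: "q \<in> cdom c" "q \<in> cdom c'"
    and h: "h \<in> sym2_fields A"
  shows "tcomp A h c (cmap c q)
    = transpose (matrix (jac c c' q)) ** tcomp A h c' (cmap c' q) ** matrix (jac c c' q)"
proof -
  let ?J = "matrix (jac c c' q)" and ?G = "tcomp A h c' (cmap c' q)"
  have J: "jac c c' q v = ?J *v v" for v
    using has_derivative_linear[OF transition_has_derivative[OF A c q]]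
    by (simp add: matrix_works linear_matrix_vector_mul_eq)
  have inner: "u \<bullet> (tcomp A h c (cmap c q) *v v) = u \<bullet> ((transpose ?J ** ?G ** ?J) *v v)" for u v
  proof -
    have "u \<bullet> (tcomp A h c (cmap c q) *v v) = jac c c' q u \<bullet> (?G *v jac c c' q v)"
      unfolding sym2_fields_eq_tcomp[OF A c(1) q(1) h, symmetric]
        sym2_fields_eq_tcomp[OF A c(2) q(2) h, symmetric]
      by (simp only: chart_vec_chart_change[OF A c q])
    also have "\<dots> = (?J *v u) \<bullet> (?G *v (?J *v v))"
      by (simp only: J)
    also have "\<dots> = u \<bullet> (transpose ?J *v (?G *v (?J *v v)))"
      by (metis dot_lmul_matrix vector_transpose_matrix)
    finally show ?thesis
      by (simp add: matrix_vector_mul_assoc matrix_mul_assoc)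
  qed
  have "tcomp A h c (cmap c q) *v v = (transpose ?J ** ?G ** ?J) *v v" for v
    by (rule vector_eq_ldot[THEN iffD1]) (intro allI inner)
  then show ?thesis
    by (intro matrix_eq[THEN iffD2] allI)
qed

lemma metrics_imp_sym2_fields: "g \<in> metrics A \<Longrightarrow> g \<in> sym2_fields A"
  by (simp add: metrics_def)

lemma metric_pos_def:
  assumes A: "smooth_atlas A" and c: "c \<in> A" and q: "q \<in> cdom c" and g: "g \<in> metrics A" and v: "v \<noteq> 0"
  shows "v \<bullet> (tcomp A g c (cmap c q) *v v) > 0"
proof -
  have "chart_vec A c q v c = v"
    using c q by (simp add: chart_vec_def jac_self[OF A])
  with v have "chart_vec A c q v \<noteq> (\<lambda>_. 0)" by metis
  then show ?thesis
    using g chart_vec_in_tangent_space[OF A c q, of v]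
    by (auto simp: metrics_def sym2_fields_eq_tcomp[OF A c q metrics_imp_sym2_fields[OF g], symmetric])
qed

lemma tcomp_symmetric:
  assumes "smooth_atlas A" "c \<in> A" "x \<in> cimg c" "h \<in> sym2_fields A"
  shows "transpose (tcomp A h c x) = tcomp A h c x"
  using assms chart_inverse(2)[OF assms(1-3)] chart_vec_in_tangent_space[OF assms(1,2)]
  by (auto simp: transpose_def tcomp_def coord_vec_eq_chart_vec sym2_fields_def vec_eq_iff)

lemma continuous_on_tcomp:
  assumes "c \<in> A" "h \<in> sym2_fields A"
  shows "continuous_on (cimg c) (tcomp A h c)"
  using assms by (intro smooth_on_imp_continuous_on) (auto simp: sym2_fields_def)

section \<open>The Riemannian measure\<close>

definition vol_density :: "('m, 'n::finite) chart set \<Rightarrow> ('m, 'n) tensor2 \<Rightarrow> ('m, 'n) chart \<Rightarrow> real^'n \<Rightarrow> real" where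
  "vol_density A g c x = (if x \<in> cimg c then sqrt (det (tcomp A g c x)) else 0)"

lemma vol_density_pos:
  assumes A: "smooth_atlas A" and c: "c \<in> A" and g: "g \<in> metrics A" and x: "x \<in> cimg c"
  shows "det (tcomp A g c x) > 0" "vol_density A g c x > 0"
proof -
  have "v \<bullet> (tcomp A g c x *v v) > 0" if "v \<noteq> 0" for v
    using metric_pos_def[OF A c chart_inverse(2)[OF A c x] g that] by (simp add: chart_inverse(4)[OF A c x])
  then show "det (tcomp A g c x) > 0"
    by (rule det_pos_if_pos_def)
  then show "vol_density A g c x > 0"
    by (simp add: vol_density_def x)
qed

lemma vol_density_nonneg:
  assumes "smooth_atlas A" "c \<in> A" "g \<in> metrics A"
  shows "vol_density A g c x \<ge> 0"
  using vol_density_pos(2)[OF assms, of x] by (cases "x \<in> cimg c") (auto simp: vol_density_def)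

lemma continuous_on_vol_density:
  assumes "c \<in> A" "g \<in> metrics A"
  shows "continuous_on (cimg c) (vol_density A g c)"
proof -
  have "continuous_on (cimg c) (\<lambda>x. sqrt (det (tcomp A g c x)))"
    by (intro continuous_intros continuous_on_det continuous_on_tcomp assms metrics_imp_sym2_fields)
  then show ?thesis
    by (rule continuous_on_eq) (simp add: vol_density_def)
qed

lemma vol_density_measurable:
  assumes "smooth_atlas A" "c \<in> A" "g \<in> metrics A"
  shows "vol_density A g c \<in> borel_measurable borel"
proof -
  have "(\<lambda>x. indicator (cimg c) x *\<^sub>R vol_density A g c x) \<in> borel_measurable borel"
    by (intro borel_measurable_continuous_on_indicator continuous_on_vol_density borel_open
        chart_homeomorphism[OF assms(1,2)] assms)
  also have "(\<lambda>x. indicator (cimg c) x *\<^sub>R vol_density A g c x) = vol_density A g c"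
    by (auto simp: vol_density_def indicator_def)
  finally show ?thesis .
qed

text \<open>Taking determinants in the tensor law \<open>G = J\<^sup>T G' J\<close> gives \<open>det G = (det J)\<^sup>2 det G'\<close>.\<close>

lemma vol_density_chart_change:
  assumes A: "smooth_atlas A" and c: "c \<in> A" "c' \<in> A" and q: "q \<in> cdom c" "q \<in> cdom c'" and g: "g \<in> metrics A"
  shows "vol_density A g c (cmap c q) = \<bar>det (matrix (jac c c' q))\<bar> * vol_density A g c' (cmap c' q)"
proof -
  have "det (tcomp A g c (cmap c q)) = (det (matrix (jac c c' q)))\<^sup>2 * det (tcomp A g c' (cmap c' q))"
    unfolding tcomp_chart_change[OF A c q metrics_imp_sym2_fields[OF g]]
    by (simp add: det_mul power2_eq_square)
  then show ?thesis
    using q by (simp add: vol_density_def chart_inverse(1)[OF A] c real_sqrt_mult)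
qed

text \<open>The inverse of a chart, made total by a constant value so that it is Borel measurable on
  the whole coordinate space.\<close>

definition chart_param :: "('m, 'n::finite) chart \<Rightarrow> real^'n \<Rightarrow> 'm" where
  "chart_param c x = (if x \<in> cimg c then cinv c x else (SOME q. True))"

lemma chart_param_measurable:
  assumes "smooth_atlas A" "c \<in> A"
  shows "chart_param c \<in> borel_measurable borel"
  unfolding chart_param_def
  using chart_homeomorphism[OF assms]
  by (intro borel_measurable_continuous_on_if borel_open continuous_on_const) (auto simp: homeomorphism_def)

lemma chart_image_eq:
  assumes "smooth_atlas A" "c \<in> A" "B \<subseteq> cdom c"
  shows "cmap c ` B = cimg c \<inter> chart_param c -` B"
  unfolding chart_image_eq_vimage[OF assms] by (auto simp: chart_param_def)

lemma chart_image_borel: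
  assumes A: "smooth_atlas A" "c \<in> A" and B: "B \<subseteq> cdom c" "B \<in> sets borel"
  shows "cmap c ` B \<in> sets borel"
  unfolding chart_image_eq[OF A B(1)]
  using measurable_sets_borel[OF chart_param_measurable[OF A] B(2)] chart_homeomorphism(2)[OF A] by auto

text \<open>The density picks up the factor \<open>\<bar>det J\<bar>\<close> that the change of variables produces.\<close>

lemma chart_volume_invariant:
  assumes A: "smooth_atlas A" and c: "c \<in> A" "c' \<in> A" and g: "g \<in> metrics A"
    and B: "B \<subseteq> cdom c" "B \<subseteq> cdom c'" "B \<in> sets borel"
  shows "(\<integral>\<^sup>+x\<in>cmap c ` B. ennreal (vol_density A g c x) \<partial>lborel)
    = (\<integral>\<^sup>+x\<in>cmap c' ` B. ennreal (vol_density A g c' x) \<partial>lborel)"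
proof -
  let ?S = "cmap c ` B" and ?\<tau> = "transition c c'"
  let ?f = "\<lambda>x. \<bar>det (matrix (frechet_derivative ?\<tau> (at x)))\<bar> * vol_density A g c' (?\<tau> x)"
  have im: "?\<tau> ` ?S = cmap c' ` B"
    unfolding image_image using B(1) by (intro image_cong refl transition_chart[OF A c(1)]) blast
  have f: "?f x = vol_density A g c x" if "x \<in> ?S" for x
  proof -
    from that obtain q where "q \<in> B" "x = cmap c q" by auto
    then show ?thesis
      using B by (simp add: transition_chart[OF A c(1)] subset_eq vol_density_chart_change[OF A c _ _ g])
  qed
  have meas: "set_borel_measurable borel X u" if "X \<in> sets borel" "u \<in> borel_measurable borel"
    for X and u :: "real^'b \<Rightarrow> real"
    unfolding set_borel_measurable_def using that by measurable
  have "(\<integral>\<^sup>+x\<in>cmap c' ` B. ennreal (vol_density A g c' x) \<partial>lborel) = (\<integral>\<^sup>+x\<in>?S. ennreal (?f x) \<partial>lborel)"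
    unfolding im[symmetric]
  proof (rule nn_integral_change_of_variables)
    show "?S \<in> sets borel" "?\<tau> ` ?S \<in> sets borel"
      unfolding im by (rule chart_image_borel[OF A c(1) B(1,3)], rule chart_image_borel[OF A c(2) B(2,3)])
    show "(?\<tau> has_derivative frechet_derivative ?\<tau> (at x)) (at x within ?S)" if "x \<in> ?S" for x
    proof -
      from that obtain q where "q \<in> B" and x: "x = cmap c q" by blast
      then have "q \<in> cdom c" "q \<in> cdom c'" using B by blast+
      from transition_has_derivative[OF A c this] show ?thesis
        unfolding x by (rule has_derivative_at_withinI)
    qed
    show "inj_on ?\<tau> ?S"
    proof (rule inj_onI)
      fix x y assume "x \<in> ?S" "y \<in> ?S" "?\<tau> x = ?\<tau> y"
      then obtain q r where qr: "q \<in> B" "r \<in> B" "x = cmap c q" "y = cmap c r"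
        by blast
      then have dom: "q \<in> cdom c" "q \<in> cdom c'" "r \<in> cdom c" "r \<in> cdom c'"
        using B by blast+
      then have "cmap c' q = cmap c' r"
        using \<open>?\<tau> x = ?\<tau> y\<close> qr by (simp add: transition_chart[OF A c(1)])
      then have "q = r"
        using chart_inverse(3)[OF A c(2)] dom by metis
      with qr show "x = y" by simp
    qed
    show "set_borel_measurable borel (?\<tau> ` ?S) (vol_density A g c')"
      unfolding im by (intro meas chart_image_borel[OF A c(2)] vol_density_measurable[OF A] c B g)
    have "set_borel_measurable borel ?S (vol_density A g c)"
      by (intro meas chart_image_borel[OF A c(1)] vol_density_measurable[OF A] c B g)
    moreover have "(\<lambda>x. indicator ?S x *\<^sub>R ?f x) = (\<lambda>x. indicator ?S x *\<^sub>R vol_density A g c x)"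
      using f by (auto simp: indicator_def)
    ultimately show "set_borel_measurable borel ?S ?f"
      by (simp only: set_borel_measurable_def)
  qed (use vol_density_nonneg[OF A c(2) g] in auto)
  also have "\<dots> = (\<integral>\<^sup>+x\<in>?S. ennreal (vol_density A g c x) \<partial>lborel)"
    by (intro nn_integral_cong) (auto simp: indicator_def f)
  finally show ?thesis by simp
qed

text \<open>The sets \<open>P k\<close> partition the manifold into finitely many Borel pieces. The coordinate
  image of a piece lies in a compact subset of the image of its chart, which makes continuous
  functions of the coordinates bounded on it.\<close>

definition chart_partition ::
  "('m::topological_space, 'n::finite) chart set \<Rightarrow> nat \<Rightarrow> (nat \<Rightarrow> ('m, 'n) chart) \<Rightarrow> (nat \<Rightarrow> (real^'n) set) \<Rightarrow> (nat \<Rightarrow> 'm set) \<Rightarrow> bool" where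
  "chart_partition A N \<phi> K P \<longleftrightarrow>
     (\<forall>k<N. \<phi> k \<in> A \<and> compact (K k) \<and> K k \<subseteq> cimg (\<phi> k) \<and>
        P k \<in> sets borel \<and> P k \<subseteq> cdom (\<phi> k) \<and> cmap (\<phi> k) ` P k \<subseteq> K k) \<and>
     disjoint_family_on P {..<N} \<and> (\<Union>k<N. P k) = UNIV"

text \<open>Finitely many inverse images of coordinate balls cover a compact manifold; subtracting
  from each the earlier ones makes them disjoint.\<close>

lemma chart_partition_exists:
  fixes A :: "('m::topological_space, 'n::finite) chart set"
  assumes A: "smooth_atlas A" and M: "compact (UNIV :: 'm set)"
  obtains N \<phi> K P where "chart_partition A N \<phi> K P"
proof -
  have "\<exists>c r. c \<in> A \<and> q \<in> cdom c \<and> r > 0 \<and> cball (cmap c q) r \<subseteq> cimg c" for q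
  proof -
    obtain c where c: "c \<in> A" "q \<in> cdom c" by (rule atlas_cover[OF A])
    then obtain r where "r > 0" "cball (cmap c q) r \<subseteq> cimg c"
      using chart_homeomorphism(2)[OF A] chart_inverse(1)[OF A] by (meson open_contains_cball)
    with c show ?thesis by blast
  qed
  then obtain C r where Cr: "\<And>q. C q \<in> A" "\<And>q. q \<in> cdom (C q)" "\<And>q. r q > 0"
      "\<And>q. cball (cmap (C q) q) (r q) \<subseteq> cimg (C q)"
    by metis
  define U where "U q = cdom (C q) \<inter> cmap (C q) -` ball (cmap (C q) q) (r q)" for q
  have openU: "open (U q)" for q
    unfolding U_def using chart_homeomorphism[OF A Cr(1)]
    by (intro continuous_open_preimage) (auto simp: homeomorphism_def)
  have "q \<in> U q" for q
    using Cr by (simp add: U_def)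
  then have "UNIV \<subseteq> (\<Union>q\<in>UNIV. U q)" by blast
  from compactE_image[OF M openU this]
  obtain Q where Q: "finite Q" "UNIV \<subseteq> (\<Union>q\<in>Q. U q)" by metis
  define N where "N = card Q"
  obtain e where e: "bij_betw e {0..<N} Q"
    using ex_bij_betw_nat_finite[OF Q(1)] by (auto simp: N_def)
  let ?P = "disjointed (U \<circ> e)"
  have "(\<Union>k<N. ?P k) = (\<Union>k<N. U (e k))"
    using finite_UN_disjointed_eq[of "U \<circ> e" N] by (simp add: atLeast0LessThan)
  also have "\<dots> = UNIV"
    using Q(2) e by (auto simp: bij_betw_def atLeast0LessThan)
  finally have cover: "(\<Union>k<N. ?P k) = UNIV" .
  have "?P k \<subseteq> U (e k)" for k
    using disjointed_subset[of "U \<circ> e" k] by simp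
  moreover have "?P k \<in> sets borel" for k
    unfolding disjointed_def using openU by (intro sets.Diff sets.finite_UN borel_open) auto
  moreover have "disjoint_family_on ?P {..<N}"
    using disjoint_family_disjointed[of "U \<circ> e"] by (auto simp: disjoint_family_on_def)
  ultimately have "chart_partition A N (C \<circ> e) (\<lambda>k. cball (cmap (C (e k)) (e k)) (r (e k))) ?P"
    unfolding chart_partition_def using Cr cover by (fastforce simp: U_def)
  then show thesis by (rule that)
qed

definition piece_measure :: "('m::topological_space, 'n::finite) chart set \<Rightarrow> ('m, 'n) tensor2 \<Rightarrow> ('m, 'n) chart \<Rightarrow> 'm set \<Rightarrow> 'm measure" where
  "piece_measure A g c P =
     distr (density lborel (\<lambda>x. ennreal (indicator (cmap c ` P) x * vol_density A g c x))) borel (chart_param c)"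

lemma emeasure_piece_measure:
  assumes A: "smooth_atlas A" "c \<in> A" and g: "g \<in> metrics A"
    and P: "P \<subseteq> cdom c" "P \<in> sets borel" and B: "B \<in> sets borel"
  shows "emeasure (piece_measure A g c P) B
    = (\<integral>\<^sup>+x\<in>cmap c ` (B \<inter> P). ennreal (vol_density A g c x) \<partial>lborel)"
proof -
  note [measurable] = chart_param_measurable[OF A] vol_density_measurable[OF A g] chart_image_borel[OF A P] B
  have [measurable]: "chart_param c -` B \<in> sets borel"
    by (rule measurable_sets_borel) fact+
  have "emeasure (piece_measure A g c P) B
    = (\<integral>\<^sup>+x. ennreal (indicator (cmap c ` P) x * vol_density A g c x) * indicator (chart_param c -` B) x \<partial>lborel)"
    unfolding piece_measure_def by (subst emeasure_distr) (auto simp: emeasure_density)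
  also have "\<dots> = (\<integral>\<^sup>+x\<in>cmap c ` (B \<inter> P). ennreal (vol_density A g c x) \<partial>lborel)"
  proof (intro nn_integral_cong)
    fix x
    have "cmap c ` (B \<inter> P) = cmap c ` P \<inter> chart_param c -` B"
      using P chart_image_eq[OF A, of "B \<inter> P"] chart_image_eq[OF A, of P] by auto
    then show "ennreal (indicator (cmap c ` P) x * vol_density A g c x) * indicator (chart_param c -` B) x
        = ennreal (vol_density A g c x) * indicator (cmap c ` (B \<inter> P)) x"
      by (simp add: indicator_def)
  qed
  finally show ?thesis .
qed

lemma emeasure_partition:
  assumes P: "chart_partition A N \<phi> K P" and \<mu>: "sets \<mu> = sets borel" and B: "B \<in> sets borel"
  shows "emeasure \<mu> B = (\<Sum>k<N. emeasure \<mu> (B \<inter> P k))"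
proof -
  have "B = (\<Union>k<N. B \<inter> P k)"
    using P by (auto simp: chart_partition_def)
  also have "emeasure \<mu> \<dots> = (\<Sum>k<N. emeasure \<mu> (B \<inter> P k))"
  proof (rule sum_emeasure[symmetric])
    show "(\<lambda>k. B \<inter> P k) ` {..<N} \<subseteq> sets \<mu>"
      using P B \<mu> by (auto simp: chart_partition_def)
    show "disjoint_family_on (\<lambda>k. B \<inter> P k) {..<N}"
      using P unfolding chart_partition_def disjoint_family_on_def by blast
  qed simp
  finally show ?thesis .
qed

text \<open>The property in the definite description of \<open>riem_volume\<close>.\<close>

definition riem_volume_like :: "('m::topological_space, 'n::finite) chart set \<Rightarrow> ('m, 'n) tensor2 \<Rightarrow> 'm measure \<Rightarrow> bool" where
  "riem_volume_like A g \<mu> \<longleftrightarrow> sets \<mu> = sets borel \<and>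
     (\<forall>c\<in>A. \<forall>B\<in>sets borel. B \<subseteq> cdom c \<longrightarrow>
        emeasure \<mu> B = (\<integral>\<^sup>+x \<in> cmap c ` B. ennreal (sqrt (det (tcomp A g c x))) \<partial>lborel))"

lemma set_nn_integral_vol_density:
  assumes "smooth_atlas A" "c \<in> A" "B \<subseteq> cdom c"
  shows "(\<integral>\<^sup>+x \<in> cmap c ` B. ennreal (sqrt (det (tcomp A g c x))) \<partial>lborel)
    = (\<integral>\<^sup>+x \<in> cmap c ` B. ennreal (vol_density A g c x) \<partial>lborel)"
  using assms by (intro nn_integral_cong) (auto simp: indicator_def vol_density_def dest: chart_inverse(1))

text \<open>The sum of the measures of the pieces works: for a set inside a chart \<open>c\<close>, each summand can
  be moved to \<open>c\<close> by a change of variables, and there the summands add up.\<close>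

lemma riem_volume_like_exists:
  assumes A: "smooth_atlas A" and P: "chart_partition A N \<phi> K P" and g: "g \<in> metrics A"
  shows "\<exists>\<mu>. riem_volume_like A g \<mu>"
proof -
  let ?\<nu> = "\<lambda>k. piece_measure A g (\<phi> k) (P k)"
  define \<mu> where "\<mu> = measure_of UNIV (sets borel) (\<lambda>B. \<Sum>k<N. emeasure (?\<nu> k) B)"
  have sets: "sets \<mu> = sets borel"
    unfolding \<mu>_def by (simp add: sets_measure_of_conv sets.sigma_sets_eq[of borel, simplified])
  have \<phi>: "\<phi> k \<in> A" "P k \<subseteq> cdom (\<phi> k)" "P k \<in> sets borel" if "k < N" for k
    using P that by (auto simp: chart_partition_def)
  have em: "emeasure \<mu> B = (\<Sum>k<N. emeasure (?\<nu> k) B)" if "B \<in> sets borel" for B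
  proof (rule emeasure_measure_of[OF \<mu>_def])
    show "countably_additive (sets \<mu>) (\<lambda>B. \<Sum>k<N. emeasure (?\<nu> k) B)"
    proof (rule countably_additiveI)
      fix F :: "nat \<Rightarrow> 'a set" assume F: "range F \<subseteq> sets \<mu>" "disjoint_family F"
      have "(\<Sum>i. \<Sum>k<N. emeasure (?\<nu> k) (F i)) = (\<Sum>k<N. \<Sum>i. emeasure (?\<nu> k) (F i))"
        by (rule suminf_sum) simp
      also have "\<dots> = (\<Sum>k<N. emeasure (?\<nu> k) (\<Union>i. F i))"
        using F by (intro sum.cong refl suminf_emeasure) (auto simp: sets piece_measure_def)
      finally show "(\<Sum>i. \<Sum>k<N. emeasure (?\<nu> k) (F i)) = (\<Sum>k<N. emeasure (?\<nu> k) (\<Union>i. F i))" .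
    qed
  qed (use that in \<open>auto simp: sets positive_def\<close>)
  have "emeasure \<mu> B = (\<integral>\<^sup>+x \<in> cmap c ` B. ennreal (sqrt (det (tcomp A g c x))) \<partial>lborel)"
    if c: "c \<in> A" and B: "B \<in> sets borel" "B \<subseteq> cdom c" for c B
  proof -
    have "emeasure \<mu> B = (\<Sum>k<N. \<integral>\<^sup>+x\<in>cmap (\<phi> k) ` (B \<inter> P k). ennreal (vol_density A g (\<phi> k) x) \<partial>lborel)"
      unfolding em[OF B(1)] by (intro sum.cong refl emeasure_piece_measure A g B \<phi>) auto
    also have "\<dots> = (\<Sum>k<N. \<integral>\<^sup>+x\<in>cmap c ` (B \<inter> P k). ennreal (vol_density A g c x) \<partial>lborel)"
      using B \<phi> c by (intro sum.cong refl chart_volume_invariant A g) auto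
    also have "\<dots> = (\<Sum>k<N. emeasure (piece_measure A g c B) (P k))"
      using B \<phi> c by (intro sum.cong refl) (simp add: emeasure_piece_measure[OF A c g] Int_commute)
    also have "\<dots> = emeasure (piece_measure A g c B) UNIV"
      by (subst emeasure_partition[OF P]) (simp_all add: piece_measure_def)
    also have "\<dots> = (\<integral>\<^sup>+x\<in>cmap c ` B. ennreal (vol_density A g c x) \<partial>lborel)"
      using B by (simp add: emeasure_piece_measure[OF A c g])
    finally show ?thesis
      using set_nn_integral_vol_density[OF A c B(2)] by simp
  qed
  with sets have "riem_volume_like A g \<mu>"
    by (simp add: riem_volume_like_def)
  then show ?thesis ..
qed

lemma riem_volume_like_unique:
  assumes P: "chart_partition A N \<phi> K P" and \<mu>: "riem_volume_like A g \<mu>" and \<nu>: "riem_volume_like A g \<nu>"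
  shows "\<mu> = \<nu>"
proof (rule measure_eqI)
  show "sets \<mu> = sets \<nu>"
    using \<mu> \<nu> by (simp add: riem_volume_like_def)
  fix B assume "B \<in> sets \<mu>"
  then have B: "B \<in> sets borel"
    using \<mu> by (simp add: riem_volume_like_def)
  have "emeasure \<mu> (B \<inter> P k) = emeasure \<nu> (B \<inter> P k)" if k: "k < N" for k
  proof -
    have "\<phi> k \<in> A" "B \<inter> P k \<in> sets borel" "B \<inter> P k \<subseteq> cdom (\<phi> k)"
      using P B k by (auto simp: chart_partition_def)
    with \<mu> \<nu> show ?thesis
      by (simp add: riem_volume_like_def)
  qed
  moreover have "sets \<mu> = sets borel" "sets \<nu> = sets borel"
    using \<mu> \<nu> by (auto simp: riem_volume_like_def)
  ultimately show "emeasure \<mu> B = emeasure \<nu> B"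
    using emeasure_partition[OF P _ B] by simp
qed

lemma riem_volume_like_riem_volume:
  assumes A: "smooth_atlas A" and P: "chart_partition A N \<phi> K P" and g: "g \<in> metrics A"
  shows "riem_volume_like A g (riem_volume A g)"
proof -
  obtain \<mu> where \<mu>: "riem_volume_like A g \<mu>"
    using riem_volume_like_exists[OF assms] by blast
  have "riem_volume A g = (THE \<mu>. riem_volume_like A g \<mu>)"
    by (simp add: riem_volume_def riem_volume_like_def)
  also have "riem_volume_like A g \<dots>"
    using \<mu> riem_volume_like_unique[OF P] by (blast intro: theI)
  finally show ?thesis .
qed

lemma sets_riem_volume:
  assumes "smooth_atlas A" "chart_partition A N \<phi> K P" "g \<in> metrics A"
  shows "sets (riem_volume A g) = sets borel" "space (riem_volume A g) = UNIV"
proof -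
  show s: "sets (riem_volume A g) = sets borel"
    using riem_volume_like_riem_volume[OF assms] by (simp add: riem_volume_like_def)
  show "space (riem_volume A g) = UNIV"
    using sets_eq_imp_space_eq[OF s] by simp
qed

lemma emeasure_riem_volume:
  assumes "smooth_atlas A" "chart_partition A N \<phi> K P" "g \<in> metrics A"
    and "c \<in> A" "B \<in> sets borel" "B \<subseteq> cdom c"
  shows "emeasure (riem_volume A g) B = (\<integral>\<^sup>+x \<in> cmap c ` B. ennreal (vol_density A g c x) \<partial>lborel)"
  using riem_volume_like_riem_volume[OF assms(1-3)] assms(4-)
  by (simp add: riem_volume_like_def set_nn_integral_vol_density[OF assms(1,4,6)])

lemma finite_measure_riem_volume:
  assumes A: "smooth_atlas A" and P: "chart_partition A N \<phi> K P" and g: "g \<in> metrics A"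
  shows "finite_measure (riem_volume A g)"
proof (rule finite_measureI)
  have "emeasure (riem_volume A g) (P k) < \<infinity>" if k: "k < N" for k
  proof -
    have pk: "\<phi> k \<in> A" "compact (K k)" "K k \<subseteq> cimg (\<phi> k)" "P k \<in> sets borel" "P k \<subseteq> cdom (\<phi> k)"
        "cmap (\<phi> k) ` P k \<subseteq> K k"
      using P k by (auto simp: chart_partition_def)
    have "continuous_on (K k) (vol_density A g (\<phi> k))"
      using continuous_on_vol_density[OF pk(1) g] pk(3) by (rule continuous_on_subset)
    then have "bounded (vol_density A g (\<phi> k) ` K k)"
      using pk(2) by (intro compact_imp_bounded compact_continuous_image)
    then obtain C where C: "\<And>x. x \<in> K k \<Longrightarrow> vol_density A g (\<phi> k) x \<le> C"
      by (auto simp: bounded_iff) (metis abs_le_D1)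
    have "emeasure (riem_volume A g) (P k) \<le> (\<integral>\<^sup>+x. ennreal C * indicator (K k) x \<partial>lborel)"
      unfolding emeasure_riem_volume[OF A P g pk(1,4,5)] using pk(6) C
      by (intro nn_integral_mono) (auto simp: indicator_def intro!: ennreal_leI)
    also have "\<dots> = ennreal C * emeasure lborel (K k)"
      using pk(2) by (intro nn_integral_cmult_indicator) (simp add: borel_compact)
    also have "\<dots> < \<infinity>"
      using emeasure_bounded_finite[OF compact_imp_bounded[OF pk(2)]] by (simp add: ennreal_mult_less_top)
    finally show ?thesis .
  qed
  then show "emeasure (riem_volume A g) (space (riem_volume A g)) \<noteq> \<infinity>"
    using emeasure_partition[OF P sets_riem_volume(1)[OF A P g], of UNIV]
    by (simp add: sets_riem_volume(2)[OF A P g] less_top)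
qed

lemma density_riem_volume_piece:
  assumes A: "smooth_atlas A" and P: "chart_partition A N \<phi> K P" and g: "g \<in> metrics A" and k: "k < N"
  shows "density (riem_volume A g) (\<lambda>q. ennreal (indicator (P k) q)) = piece_measure A g (\<phi> k) (P k)"
proof (rule measure_eqI)
  note sets = sets_riem_volume(1)[OF A P g]
  show "sets (density (riem_volume A g) (\<lambda>q. ennreal (indicator (P k) q))) = sets (piece_measure A g (\<phi> k) (P k))"
    by (simp add: sets piece_measure_def)
  fix B assume "B \<in> sets (density (riem_volume A g) (\<lambda>q. ennreal (indicator (P k) q)))"
  then have B: "B \<in> sets borel" by (simp add: sets)
  have pk: "\<phi> k \<in> A" "P k \<in> sets borel" "P k \<subseteq> cdom (\<phi> k)"
    using P k by (auto simp: chart_partition_def)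
  have "emeasure (density (riem_volume A g) (\<lambda>q. ennreal (indicator (P k) q))) B
      = (\<integral>\<^sup>+q. indicator (B \<inter> P k) q \<partial>riem_volume A g)"
  proof -
    have "(\<lambda>q. ennreal (indicator (P k) q)) \<in> borel_measurable (riem_volume A g)"
      using pk(2) sets by (intro measurable_compose[OF _ measurable_ennreal] borel_measurable_indicator) simp
    then have "emeasure (density (riem_volume A g) (\<lambda>q. ennreal (indicator (P k) q))) B
        = (\<integral>\<^sup>+q. ennreal (indicator (P k) q) * indicator B q \<partial>riem_volume A g)"
      using B sets by (intro emeasure_density) auto
    also have "\<dots> = (\<integral>\<^sup>+q. indicator (B \<inter> P k) q \<partial>riem_volume A g)"
      by (intro nn_integral_cong) (simp split: split_indicator)
    finally show ?thesis .
  qed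
  also have "\<dots> = emeasure (riem_volume A g) (B \<inter> P k)"
    using B pk(2) by (simp add: sets)
  also have "\<dots> = emeasure (piece_measure A g (\<phi> k) (P k)) B"
    using B pk by (simp add: emeasure_piece_measure[OF A _ g] emeasure_riem_volume[OF A P g pk(1)] le_infI2)
  finally show "emeasure (density (riem_volume A g) (\<lambda>q. ennreal (indicator (P k) q))) B
      = emeasure (piece_measure A g (\<phi> k) (P k)) B" .
qed

text \<open>The bridge from the manifold to Lebesgue measure: integrals are finite sums of integrals in
  coordinates, over regions that do not depend on the metric.\<close>

lemma integral_riem_volume:
  fixes f :: "'m::topological_space \<Rightarrow> real"
  assumes A: "smooth_atlas A" and P: "chart_partition A N \<phi> K P" and g: "g \<in> metrics A"
    and f: "f \<in> borel_measurable borel" "\<And>q. \<bar>f q\<bar> \<le> C"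
  shows "integrable (riem_volume A g) f"
    and "k < N \<Longrightarrow> integrable lborel (\<lambda>x. indicator (cmap (\<phi> k) ` P k) x * vol_density A g (\<phi> k) x * f (chart_param (\<phi> k) x))"
    and "(LINT q|riem_volume A g. f q) =
      (\<Sum>k<N. LINT x|lborel. indicator (cmap (\<phi> k) ` P k) x * vol_density A g (\<phi> k) x * f (chart_param (\<phi> k) x))"
proof -
  interpret finite_measure "riem_volume A g"
    by (rule finite_measure_riem_volume[OF A P g])
  note sets = sets_riem_volume(1)[OF A P g]
  have meas: "borel_measurable (riem_volume A g) = (borel_measurable borel :: ('m \<Rightarrow> real) set)"
    by (intro measurable_cong_sets sets refl)
  have pk: "\<phi> k \<in> A" "P k \<in> sets borel" "P k \<subseteq> cdom (\<phi> k)" if "k < N" for k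
    using P that by (auto simp: chart_partition_def)
  show int: "integrable (riem_volume A g) f"
    using f by (intro integrable_const_bound[of _ C]) (auto simp: meas)
  have intP: "integrable (riem_volume A g) (\<lambda>q. indicator (P k) q *\<^sub>R f q)" if "k < N" for k
    using pk[OF that] sets by (intro integrable_mult_indicator int) auto
  have piece: "integrable (piece_measure A g (\<phi> k) (P k)) f \<and>
      (LINT q|piece_measure A g (\<phi> k) (P k). f q) = (LINT q|riem_volume A g. indicator (P k) q *\<^sub>R f q)" if "k < N" for k
    unfolding density_riem_volume_piece[OF A P g that, symmetric]
    using intP[OF that] f pk[OF that] by (simp add: integrable_density integral_density meas)
  have local: "integrable (piece_measure A g (\<phi> k) (P k)) f \<longleftrightarrow>
        integrable lborel (\<lambda>x. indicator (cmap (\<phi> k) ` P k) x * vol_density A g (\<phi> k) x * f (chart_param (\<phi> k) x))"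
      "(LINT q|piece_measure A g (\<phi> k) (P k). f q) =
        (LINT x|lborel. indicator (cmap (\<phi> k) ` P k) x * vol_density A g (\<phi> k) x * f (chart_param (\<phi> k) x))"
    if k: "k < N" for k
  proof -
    note [measurable] = chart_param_measurable[OF A pk(1)[OF k]] vol_density_measurable[OF A pk(1)[OF k] g]
      chart_image_borel[OF A pk(1,3,2)[OF k]] f(1)
    have [simp]: "0 \<le> indicator (cmap (\<phi> k) ` P k) x * vol_density A g (\<phi> k) x" for x
      using vol_density_nonneg[OF A pk(1)[OF k] g] by simp
    show "integrable (piece_measure A g (\<phi> k) (P k)) f \<longleftrightarrow>
        integrable lborel (\<lambda>x. indicator (cmap (\<phi> k) ` P k) x * vol_density A g (\<phi> k) x * f (chart_param (\<phi> k) x))"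
      unfolding piece_measure_def
      by (subst integrable_distr_eq) (simp_all add: integrable_density)
    show "(LINT q|piece_measure A g (\<phi> k) (P k). f q) =
        (LINT x|lborel. indicator (cmap (\<phi> k) ` P k) x * vol_density A g (\<phi> k) x * f (chart_param (\<phi> k) x))"
      unfolding piece_measure_def
      by (subst integral_distr) (simp_all add: integral_density)
  qed
  show "k < N \<Longrightarrow> integrable lborel (\<lambda>x. indicator (cmap (\<phi> k) ` P k) x * vol_density A g (\<phi> k) x * f (chart_param (\<phi> k) x))"
    using piece local(1) by blast
  have "f q = (\<Sum>k<N. indicator (P k) q *\<^sub>R f q)" for q
  proof -
    have "q \<in> (\<Union>k<N. P k)"
      using P by (simp add: chart_partition_def)
    then obtain j where j: "j < N" "q \<in> P j"
      by blast
    have "indicator (P k) q *\<^sub>R f q = (if k = j then f q else 0)" if "k < N" for k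
    proof -
      have "q \<notin> P k" if "k \<noteq> j"
        using P j \<open>k < N\<close> that unfolding chart_partition_def disjoint_family_on_def by blast
      then show ?thesis
        using j by (simp add: indicator_def)
    qed
    then have "(\<Sum>k<N. indicator (P k) q *\<^sub>R f q) = (\<Sum>k<N. if k = j then f q else 0)"
      by (intro sum.cong) auto
    with j(1) show ?thesis by simp
  qed
  then have "(LINT q|riem_volume A g. f q) = (LINT q|riem_volume A g. (\<Sum>k<N. indicator (P k) q *\<^sub>R f q))"
    by presburger
  also have "\<dots> = (\<Sum>k<N. LINT q|riem_volume A g. indicator (P k) q *\<^sub>R f q)"
    using intP by (intro Bochner_Integration.integral_sum) auto
  also have "\<dots> = (\<Sum>k<N. LINT x|lborel. indicator (cmap (\<phi> k) ` P k) x * vol_density A g (\<phi> k) x * f (chart_param (\<phi> k) x))"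
    using piece local(2) by (intro sum.cong) auto
  finally show "(LINT q|riem_volume A g. f q) =
      (\<Sum>k<N. LINT x|lborel. indicator (cmap (\<phi> k) ` P k) x * vol_density A g (\<phi> k) x * f (chart_param (\<phi> k) x))" .
qed

section \<open>Differentiation under the integral\<close>

lemma has_vector_derivative_iff_quotient:
  fixes f :: "real \<Rightarrow> 'a::real_normed_vector"
  shows "(f has_vector_derivative f') (at t within I)
    \<longleftrightarrow> ((\<lambda>s. (f s - f t) /\<^sub>R (s - t)) \<longlongrightarrow> f') (at t within I)"
proof -
  have "(f has_vector_derivative f') (at t within I)
      \<longleftrightarrow> ((\<lambda>s. norm ((f s - f t) - (s - t) *\<^sub>R f') / norm (s - t)) \<longlongrightarrow> 0) (at t within I)"
    by (simp add: has_vector_derivative_def has_derivative_iff_norm bounded_linear_scaleR_left)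
  also have "\<dots> \<longleftrightarrow> ((\<lambda>s. norm ((f s - f t) /\<^sub>R (s - t) - f')) \<longlongrightarrow> 0) (at t within I)"
  proof (intro filterlim_cong refl)
    have "norm ((f s - f t) - (s - t) *\<^sub>R f') / norm (s - t) = norm ((f s - f t) /\<^sub>R (s - t) - f')"
      if "s \<noteq> t" for s
    proof -
      have "(f s - f t) /\<^sub>R (s - t) - f' = ((f s - f t) - (s - t) *\<^sub>R f') /\<^sub>R (s - t)"
        using that by (simp add: scaleR_right_diff_distrib)
      then show ?thesis
        by (simp add: divide_inverse mult.commute)
    qed
    then show "\<forall>\<^sub>F s in at t within I. norm ((f s - f t) - (s - t) *\<^sub>R f') / norm (s - t)
        = norm ((f s - f t) /\<^sub>R (s - t) - f')"
      by (auto simp: eventually_at_filter)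
  qed
  finally show ?thesis
    by (simp add: tendsto_norm_zero_iff LIM_zero_iff)
qed

text \<open>Differentiation under the integral at a possibly one-sided point \<open>t\<close>. By the mean value
  inequality on the convex set \<open>I \<inter> ball t \<delta>\<close>, the difference quotients are bounded by the same
  constant as the derivatives, and dominated convergence applies along every sequence tending
  to \<open>t\<close>.\<close>

lemma integral_has_real_derivative:
  fixes F F' :: "real \<Rightarrow> 'a \<Rightarrow> real"
  assumes I: "convex I" "t \<in> I" and fin: "finite_measure M"
    and der: "\<And>s x. s \<in> I \<Longrightarrow> x \<in> space M \<Longrightarrow> ((\<lambda>s. F s x) has_real_derivative F' s x) (at s within I)"
    and int: "\<And>s. s \<in> I \<Longrightarrow> integrable M (F s)"
    and meas: "F' t \<in> borel_measurable M"
    and bound: "\<delta> > 0" "\<And>s x. s \<in> I \<Longrightarrow> \<bar>s - t\<bar> < \<delta> \<Longrightarrow> x \<in> space M \<Longrightarrow> \<bar>F' s x\<bar> \<le> C"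
  shows "((\<lambda>s. LINT x|M. F s x) has_real_derivative (LINT x|M. F' t x)) (at t within I)"
proof -
  interpret finite_measure M by fact
  let ?q = "\<lambda>s x. (F s x - F t x) / (s - t)"
  have "((\<lambda>s. LINT x|M. ?q s x) \<longlongrightarrow> (LINT x|M. F' t x)) (at t within I)"
  proof (subst tendsto_at_iff_sequentially, intro allI impI)
    fix X assume "\<forall>i. X i \<in> I - {t}" and X: "X \<longlonglongrightarrow> t"
    then have XI: "X i \<in> I" "X i \<noteq> t" for i by auto
    \<comment> \<open>The bound holds only near \<open>t\<close>, so a finite part of the sequence is dropped.\<close>
    obtain m where m: "\<bar>X i - t\<bar> < \<delta>" if "i \<ge> m" for i
      using LIMSEQ_D[OF X bound(1)] by (auto simp: dist_real_def)
    have "(\<lambda>i. LINT x|M. ?q (X (i + m)) x) \<longlonglongrightarrow> (LINT x|M. F' t x)"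
    proof (rule integral_dominated_convergence[where w="\<lambda>_. C"])
      show "F' t \<in> borel_measurable M" by (rule meas)
      show "?q (X (i + m)) \<in> borel_measurable M" for i
        using int[OF XI(1)] int[OF I(2)] by (intro borel_measurable_divide borel_measurable_diff) auto
      show "integrable M (\<lambda>_. C)" by simp
      show "AE x in M. (\<lambda>i. ?q (X (i + m)) x) \<longlonglongrightarrow> F' t x"
      proof (rule AE_I2)
        fix x assume x: "x \<in> space M"
        from der[OF I(2) x] have "((\<lambda>s. ?q s x) \<longlongrightarrow> F' t x) (at t within I)"
          by (simp add: has_field_derivative_iff)
        then have "(\<lambda>i. ?q (X i) x) \<longlonglongrightarrow> F' t x"
          using XI X by (subst (asm) tendsto_at_iff_sequentially) (auto simp: o_def)
        then show "(\<lambda>i. ?q (X (i + m)) x) \<longlonglongrightarrow> F' t x"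
          by (rule LIMSEQ_ignore_initial_segment)
      qed
      show "AE x in M. norm (?q (X (i + m)) x) \<le> C" for i
      proof (rule AE_I2)
        fix x assume x: "x \<in> space M"
        let ?s = "X (i + m)" and ?J = "I \<inter> ball t \<delta>"
        have "norm (F ?s x - F t x) \<le> C * norm (?s - t)"
        proof (rule field_differentiable_bound)
          show "convex ?J" using I(1) by (intro convex_Int convex_ball)
          show "((\<lambda>s. F s x) has_real_derivative F' z x) (at z within ?J)" if "z \<in> ?J" for z
            using that by (intro DERIV_subset[OF der]) (auto intro: x)
          show "norm (F' z x) \<le> C" if "z \<in> ?J" for z
            using bound(2)[of z x] that x by (auto simp: dist_real_def abs_minus_commute)
          show "?s \<in> ?J" "t \<in> ?J"
            using XI m[of "i + m"] I(2) bound(1) by (auto simp: dist_real_def abs_minus_commute)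
        qed
        then show "norm (?q ?s x) \<le> C"
          using XI(2)[of "i + m"] by (simp add: norm_divide pos_divide_le_eq)
      qed
    qed
    then have "(\<lambda>i. LINT x|M. ?q (X i) x) \<longlonglongrightarrow> (LINT x|M. F' t x)"
      by (rule LIMSEQ_offset)
    then show "((\<lambda>s. LINT x|M. ?q s x) \<circ> X) \<longlonglongrightarrow> (LINT x|M. F' t x)"
      by (simp add: o_def)
  qed
  moreover have "\<forall>\<^sub>F s in at t within I. (LINT x|M. ?q s x) = ((LINT x|M. F s x) - (LINT x|M. F t x)) / (s - t)"
    using int I(2) by (auto simp: eventually_at_filter)
  ultimately show ?thesis
    unfolding has_field_derivative_iff by (rule Lim_transform_eventually)
qed

lemma uniform_limit_imp_eventually_bounded:
  fixes f :: "'s \<Rightarrow> 'a \<Rightarrow> 'b::real_normed_vector"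
  assumes lim: "uniform_limit K f l F" and l: "bounded (l ` K)"
  shows "\<exists>C. (\<forall>\<^sub>F s in F. \<forall>x\<in>K. norm (f s x) \<le> C) \<and> (\<forall>x\<in>K. norm (l x) \<le> C)"
proof -
  obtain B where B: "\<And>x. x \<in> K \<Longrightarrow> norm (l x) \<le> B"
    using l by (auto simp: bounded_iff)
  \<comment> \<open>Eventually \<open>f s\<close> is within distance \<open>1\<close> of its limit.\<close>
  have "\<forall>\<^sub>F s in F. \<forall>x\<in>K. norm (f s x) \<le> B + 1"
    using uniform_limitD[OF lim zero_less_one]
  proof eventually_elim
    case (elim s)
    show ?case
    proof
      fix x assume "x \<in> K"
      then show "norm (f s x) \<le> B + 1"
        using elim B[of x] norm_triangle_sub[of "f s x" "l x"] by (force simp: dist_norm)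
    qed
  qed
  moreover have "\<forall>x\<in>K. norm (l x) \<le> B + 1"
    using B by force
  ultimately show ?thesis by blast
qed

section \<open>The volume along the flow\<close>

lemma convex_time_dom: "convex (time_dom T)"
proof -
  have "is_interval (time_dom T)"
    unfolding is_interval_1 time_dom_def by (auto intro: le_less_trans[OF ereal_less_eq(3)[THEN iffD2]])
  then show ?thesis by (simp add: is_interval_convex_1)
qed

lemma smooth_funs_continuous:
  fixes f :: "'m::topological_space \<Rightarrow> real"
  assumes A: "smooth_atlas A" and f: "f \<in> smooth_funs A"
  shows "continuous_on UNIV f"
proof -
  have loc: "continuous_on (cdom c) f" if c: "c \<in> A" for c
  proof -
    have "continuous_on (cimg c) (fun_rep f c)"
      using f c by (intro smooth_on_imp_continuous_on) (auto simp: smooth_funs_def)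
    moreover have "continuous_on (cdom c) (cmap c)" "cmap c ` cdom c = cimg c"
      using chart_homeomorphism(3)[OF A c] by (auto simp: homeomorphism_def)
    ultimately have "continuous_on (cdom c) (fun_rep f c \<circ> cmap c)"
      by (intro continuous_on_compose) auto
    then show ?thesis
      by (rule continuous_on_eq) (simp add: fun_rep_def chart_inverse(3)[OF A c])
  qed
  have "continuous_on (\<Union>c\<in>A. cdom c) f"
    using chart_homeomorphism(1)[OF A] loc by (intro continuous_on_open_UN) auto
  then show ?thesis
    using A by (simp add: smooth_atlas_def)
qed

lemma continuous_on_compact_space_bounded:
  fixes f :: "'m::topological_space \<Rightarrow> real"
  assumes "continuous_on UNIV f" "compact (UNIV :: 'm set)"
  obtains C where "\<And>q. \<bar>f q\<bar> \<le> C"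
  using compact_imp_bounded[OF compact_continuous_image[OF assms]] by (auto simp: bounded_iff)

text \<open>The case of the empty list of partial derivatives.\<close>

lemma cinf_tendsto_uniform_limit:
  assumes "cinf_tendsto A H L F" and c: "c \<in> A" and K: "compact K" "K \<subseteq> cimg c"
  shows "uniform_limit K (\<lambda>s. H s c) (L c) F"
  using assms(1)[unfolded cinf_tendsto_def, rule_format, OF c conjI[OF K], of "[]"] by simp

text \<open>The trace of the flow equation with respect to the metric. The constraint that the scalar
  curvature is \<open>-1\<close> cancels the trace of the term \<open>G / n\<close>.\<close>

lemma conformal_ricci_flow_trace:
  fixes G R G' :: "real^'n::finite^'n"
  assumes G: "invertible G" "transpose G = G"
    and R: "(\<Sum>i\<in>UNIV. \<Sum>j\<in>UNIV. matrix_inv G $ i $ j * R $ i $ j) = -1"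
    and eq: "G' + 2 *\<^sub>R (R + (1 / real CARD('n)) *\<^sub>R G) = - (p *\<^sub>R G)"
  shows "trace (G' ** matrix_inv G) = - real CARD('n) * p"
proof -
  let ?n = "real CARD('n)"
  have sym: "matrix_inv G $ i $ j = matrix_inv G $ j $ i" for i j
  proof -
    have "matrix_inv G $ i $ j = transpose (matrix_inv G) $ j $ i"
      by (simp add: transpose_def)
    then show ?thesis
      unfolding matrix_inv_symmetric[OF G] .
  qed
  have "trace (R ** matrix_inv G) = (\<Sum>i\<in>UNIV. \<Sum>j\<in>UNIV. matrix_inv G $ i $ j * R $ i $ j)"
    unfolding trace_def matrix_matrix_mult_def vec_lambda_beta
    by (intro sum.cong refl) (subst sym, rule mult.commute)
  with R have "trace (R ** matrix_inv G) = -1" by simp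
  moreover have "trace (G ** matrix_inv G) = ?n"
    by (simp add: matrix_inv_inverse(1)[OF G(1)] trace_I)
  moreover have G': "G' = - (p *\<^sub>R G) - 2 *\<^sub>R (R + (1 / ?n) *\<^sub>R G)"
    using eq by (metis add_diff_cancel_right')
  have "trace (G' ** matrix_inv G)
      = - p * trace (G ** matrix_inv G) - 2 * (trace (R ** matrix_inv G) + 1 / ?n * trace (G ** matrix_inv G))"
    unfolding G'
    by (simp add: trace_def matrix_matrix_mult_def sum_distrib_left sum_subtractf sum.distrib sum_negf algebra_simps)
  ultimately show ?thesis by simp
qed

text \<open>Jacobi's formula turns the trace of the flow equation into a linear equation for the
  density.\<close>

lemma vol_density_has_derivative:
  fixes A :: "('m::topological_space, 'n::finite) chart set"
  assumes A: "smooth_atlas A" and flow: "conformal_ricci_flow A T g p"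
    and c: "c \<in> A" and x: "x \<in> cimg c" and t: "t \<in> time_dom T"
  shows "((\<lambda>s. vol_density A (g s) c x) has_real_derivative
    - (real CARD('n) / 2) * p t (cinv c x) * vol_density A (g t) c x) (at t within time_dom T)"
proof -
  let ?I = "time_dom T" and ?G = "\<lambda>s. tcomp A (g s) c x"
  have g: "g t \<in> metrics A" and curv: "g t \<in> metrics_neg1 A"
    using flow t by (auto simp: conformal_ricci_flow_def)
  obtain g' where g': "has_cinf_deriv A (\<lambda>s. tcomp A (g s)) g' t ?I"
    and eq: "\<And>c x. c \<in> A \<Longrightarrow> x \<in> cimg c \<Longrightarrow>
      g' c x + 2 *\<^sub>R (ricci (tcomp A (g t) c) x + (1 / real CARD('n)) *\<^sub>R tcomp A (g t) c x)
        = - (p t (cinv c x) *\<^sub>R tcomp A (g t) c x)"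
    using flow t unfolding conformal_ricci_flow_def by blast
  have "uniform_limit {x} (\<lambda>s x. (tcomp A (g s) c x - tcomp A (g t) c x) /\<^sub>R (s - t)) (g' c) (at t within ?I)"
    by (rule cinf_tendsto_uniform_limit[OF g'[unfolded has_cinf_deriv_def] c]) (use x in auto)
  then have "((\<lambda>s. (?G s - ?G t) /\<^sub>R (s - t)) \<longlongrightarrow> g' c x) (at t within ?I)"
    by (rule tendsto_uniform_limitI) simp
  then have der: "(?G has_vector_derivative g' c x) (at t within ?I)"
    by (simp add: has_vector_derivative_iff_quotient)
  have pos: "det (?G t) > 0"
    by (rule vol_density_pos(1)[OF A c g x])
  then have inv: "invertible (?G t)"
    by (simp add: invertible_det_nz)
  have "trace (g' c x ** matrix_inv (?G t)) = - real CARD('n) * p t (cinv c x)"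
  proof (rule conformal_ricci_flow_trace[OF inv _ _ eq[OF c x]])
    show "transpose (?G t) = ?G t"
      by (rule tcomp_symmetric[OF A c x metrics_imp_sym2_fields[OF g]])
    show "(\<Sum>i\<in>UNIV. \<Sum>j\<in>UNIV. matrix_inv (?G t) $ i $ j * ricci (tcomp A (g t) c) x $ i $ j) = -1"
      using curv c x by (simp add: metrics_neg1_def scalar_curvature_def)
  qed
  with det_has_real_derivative[OF der inv]
  have "((\<lambda>s. det (?G s)) has_real_derivative det (?G t) * (- real CARD('n) * p t (cinv c x))) (at t within ?I)"
    by simp
  from DERIV_chain2[OF DERIV_real_sqrt[OF pos] this]
  have "((\<lambda>s. sqrt (det (?G s))) has_real_derivative
      inverse (sqrt (det (?G t))) / 2 * (det (?G t) * (- real CARD('n) * p t (cinv c x)))) (at t within ?I)" .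
  moreover have "inverse (sqrt (det (?G t))) / 2 * (det (?G t) * (- real CARD('n) * p t (cinv c x)))
      = - (real CARD('n) / 2) * p t (cinv c x) * sqrt (det (?G t))"
  proof -
    have "inverse (sqrt (det (?G t))) / 2 * (det (?G t) * (- real CARD('n) * p t (cinv c x)))
        = (inverse (sqrt (det (?G t))) * det (?G t)) * (- (real CARD('n) / 2) * p t (cinv c x))"
      by simp
    also have "inverse (sqrt (det (?G t))) * det (?G t) = sqrt (det (?G t))"
      using real_div_sqrt[of "det (?G t)"] pos by (simp add: divide_inverse mult.commute)
    finally show ?thesis
      by (simp only: mult.commute)
  qed
  ultimately have "((\<lambda>s. sqrt (det (?G s))) has_real_derivative
      - (real CARD('n) / 2) * p t (cinv c x) * sqrt (det (?G t))) (at t within ?I)"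
    by (simp only:)
  then show ?thesis
    unfolding vol_density_def if_P[OF x] .
qed

text \<open>Near the time \<open>t\<close> and on a compact set, uniform convergence confines the components of the
  metric to a ball of matrices, on which \<open>sqrt (det H)\<close> is bounded by compactness.\<close>

lemma vol_density_deriv_bounded:
  fixes A :: "('m::topological_space, 'n::finite) chart set"
  assumes A: "smooth_atlas A" and flow: "conformal_ricci_flow A T g p"
    and c: "c \<in> A" and K: "compact K" "K \<subseteq> cimg c" and t: "t \<in> time_dom T"
  obtains \<delta> C where "\<delta> > 0"
    "\<And>s x. s \<in> time_dom T \<Longrightarrow> \<bar>s - t\<bar> < \<delta> \<Longrightarrow> x \<in> K \<Longrightarrow>
      \<bar>p s (cinv c x)\<bar> * vol_density A (g s) c x \<le> C"
proof -
  let ?F = "at t within time_dom T"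
  have gt: "g t \<in> metrics A" and pt: "p t \<in> smooth_funs A"
    using flow t by (auto simp: conformal_ricci_flow_def)
  have "cinf_tendsto A (\<lambda>s. tcomp A (g s)) (tcomp A (g t)) ?F"
    "cinf_tendsto A (\<lambda>s. fun_rep (p s)) (fun_rep (p t)) ?F"
    using flow t by (auto simp: conformal_ricci_flow_def cinf_continuous_on_def)
  note lim = this[THEN cinf_tendsto_uniform_limit, OF c K]
  have "continuous_on K (tcomp A (g t) c)"
    using continuous_on_tcomp[OF c metrics_imp_sym2_fields[OF gt]] K(2) by (rule continuous_on_subset)
  then have "bounded (tcomp A (g t) c ` K)"
    using K(1) by (intro compact_imp_bounded compact_continuous_image)
  from uniform_limit_imp_eventually_bounded[OF lim(1) this]
  obtain B where B: "\<forall>\<^sub>F s in ?F. \<forall>x\<in>K. norm (tcomp A (g s) c x) \<le> B"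
    "\<forall>x\<in>K. norm (tcomp A (g t) c x) \<le> B" by blast
  have "smooth_on (cimg c) (fun_rep (p t) c)"
    using pt c unfolding smooth_funs_def by blast
  then have "continuous_on K (fun_rep (p t) c)"
    using K(2) by (intro continuous_on_subset[OF smooth_on_imp_continuous_on])
  then have "bounded (fun_rep (p t) c ` K)"
    using K(1) by (intro compact_imp_bounded compact_continuous_image)
  from uniform_limit_imp_eventually_bounded[OF lim(2) this]
  obtain C where C: "\<forall>\<^sub>F s in ?F. \<forall>x\<in>K. norm (fun_rep (p s) c x) \<le> C"
    "\<forall>x\<in>K. norm (fun_rep (p t) c x) \<le> C" by blast
  have "bounded ((\<lambda>H :: real^'n^'n. sqrt (det H)) ` cball 0 B)"
    by (intro compact_imp_bounded compact_continuous_image continuous_intros continuous_on_det) auto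
  then obtain E where "\<forall>y\<in>(\<lambda>H :: real^'n^'n. sqrt (det H)) ` cball 0 B. norm y \<le> E"
    unfolding bounded_iff by blast
  then have E: "\<bar>sqrt (det H)\<bar> \<le> E" if "norm H \<le> B" for H :: "real^'n^'n"
    using that by simp
  from eventually_conj[OF B(1) C(1)] obtain \<delta> where \<delta>: "\<delta> > 0"
    "\<And>s. s \<in> time_dom T \<Longrightarrow> s \<noteq> t \<Longrightarrow> dist s t < \<delta> \<Longrightarrow>
      (\<forall>x\<in>K. norm (tcomp A (g s) c x) \<le> B) \<and> (\<forall>x\<in>K. norm (fun_rep (p s) c x) \<le> C)"
    unfolding eventually_at by blast
  have "\<bar>p s (cinv c x)\<bar> * vol_density A (g s) c x \<le> C * E"
    if s: "s \<in> time_dom T" "\<bar>s - t\<bar> < \<delta>" and x: "x \<in> K" for s x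
  proof -
    have "norm (tcomp A (g s) c x) \<le> B \<and> norm (fun_rep (p s) c x) \<le> C"
      using \<delta>(2)[OF s(1)] s(2) B(2) C(2) x by (cases "s = t") (auto simp: dist_real_def)
    then have "vol_density A (g s) c x \<le> E" "\<bar>p s (cinv c x)\<bar> \<le> C"
      using E[of "tcomp A (g s) c x"] K(2) x by (auto simp: vol_density_def fun_rep_def)
    moreover have "vol_density A (g s) c x \<ge> 0"
      using flow s(1) by (intro vol_density_nonneg A c) (auto simp: conformal_ricci_flow_def)
    ultimately show ?thesis
      by (intro mult_mono) auto
  qed
  with \<delta>(1) show thesis by (rule that)
qed

text \<open>On each piece the volume of \<open>D\<close> is an integral of the density over a region that is fixed in
  time, so only the density has to be differentiated.\<close>

lemma vol_has_derivative:
  fixes A :: "('m::topological_space, 'n::finite) chart set"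
  assumes A: "smooth_atlas A" and M: "compact (UNIV :: 'm set)"
    and flow: "conformal_ricci_flow A T g p"
    and D: "D \<in> sets borel" and t: "t \<in> time_dom T"
  shows "((\<lambda>s. vol A D (g s)) has_real_derivative
    - (real CARD('n) / 2) * (LINT q:D|riem_volume A (g t). p t q)) (at t within time_dom T)"
proof -
  obtain N \<phi> K P where P: "chart_partition A N \<phi> K P"
    by (rule chart_partition_exists[OF A M])
  let ?I = "time_dom T" and ?n = "real CARD('n)"
  have g: "g s \<in> metrics A" and ps: "p s \<in> smooth_funs A" if "s \<in> ?I" for s
    using flow that by (auto simp: conformal_ricci_flow_def)
  have cont: "continuous_on UNIV (p t)"
    by (rule smooth_funs_continuous[OF A ps[OF t]])
  have [measurable]: "p t \<in> borel_measurable borel" "D \<in> sets borel"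
    using cont D by (auto intro: borel_measurable_continuous_onI)
  obtain C where C: "\<And>q. \<bar>p t q\<bar> \<le> C"
    using continuous_on_compact_space_bounded[OF cont M] by blast
  have Dp: "\<bar>indicator D q * p t q\<bar> \<le> C" for q
    using C[of q] by (auto simp: indicator_def intro: order_trans[OF abs_ge_zero])
  \<comment> \<open>The indicator of \<open>D\<close> on the piece \<open>k\<close>, in coordinates.\<close>
  let ?w = "\<lambda>k x. indicator (cmap (\<phi> k) ` P k) x * indicator D (chart_param (\<phi> k) x) :: real"
  have vol: "vol A D (g s) = (\<Sum>k<N. LINT x|lborel. ?w k x * vol_density A (g s) (\<phi> k) x)" if s: "s \<in> ?I" for s
  proof -
    have "vol A D (g s) = (LINT q|riem_volume A (g s). indicator D q)"
      using D sets_riem_volume[OF A P g[OF s]] by (simp add: vol_def)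
    also have "\<dots> = (\<Sum>k<N. LINT x|lborel. indicator (cmap (\<phi> k) ` P k) x * vol_density A (g s) (\<phi> k) x
        * indicator D (chart_param (\<phi> k) x))"
      by (rule integral_riem_volume(3)[OF A P g[OF s], of _ 1]) (auto simp: indicator_def)
    finally show ?thesis
      by (simp add: ac_simps)
  qed
  have "((\<lambda>s. \<Sum>k<N. LINT x|lborel. ?w k x * vol_density A (g s) (\<phi> k) x) has_real_derivative
      (\<Sum>k<N. LINT x|lborel. ?w k x * (- (?n / 2) * p t (chart_param (\<phi> k) x) * vol_density A (g t) (\<phi> k) x)))
      (at t within ?I)"
  proof (rule DERIV_sum)
    fix k assume "k \<in> {..<N}"
    then have k: "k < N" by simp
    have pk: "\<phi> k \<in> A" "compact (K k)" "K k \<subseteq> cimg (\<phi> k)" "P k \<in> sets borel" "P k \<subseteq> cdom (\<phi> k)"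
        "cmap (\<phi> k) ` P k \<subseteq> K k"
      using P k by (auto simp: chart_partition_def)
    let ?X = "cmap (\<phi> k) ` P k" and ?M = "restrict_space lborel (cmap (\<phi> k) ` P k)"
    note [measurable] = chart_param_measurable[OF A pk(1)] vol_density_measurable[OF A pk(1) g[OF t]]
    have X [measurable]: "?X \<in> sets borel"
      by (rule chart_image_borel[OF A pk(1,5,4)])
    have sp: "space ?M = ?X"
      by (simp add: space_restrict_space)
    let ?F = "\<lambda>s x. indicator D (chart_param (\<phi> k) x) * vol_density A (g s) (\<phi> k) x"
    let ?F' = "\<lambda>s x. indicator D (chart_param (\<phi> k) x) * (- (?n / 2) * p s (cinv (\<phi> k) x) * vol_density A (g s) (\<phi> k) x)"
    have LINT: "(LINT x|lborel. ?w k x * u x) = (LINT x|?M. indicator D (chart_param (\<phi> k) x) * u x)" for u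
      by (subst integral_restrict_space) (auto simp: mult.assoc)
    obtain \<delta> C where \<delta>: "\<delta> > 0" and C: "\<And>s x. s \<in> ?I \<Longrightarrow> \<bar>s - t\<bar> < \<delta> \<Longrightarrow> x \<in> K k \<Longrightarrow>
        \<bar>p s (cinv (\<phi> k) x)\<bar> * vol_density A (g s) (\<phi> k) x \<le> C"
      using vol_density_deriv_bounded[OF A flow pk(1-3) t] by metis
    have param: "chart_param (\<phi> k) x = cinv (\<phi> k) x" if "x \<in> ?X" for x
      using that pk by (auto simp: chart_param_def)
    have "((\<lambda>s. LINT x|?M. ?F s x) has_real_derivative (LINT x|?M. ?F' t x)) (at t within ?I)"
    proof (rule integral_has_real_derivative[OF convex_time_dom t, where \<delta>=\<delta> and C="?n / 2 * C"])
      have "emeasure lborel ?X \<le> emeasure lborel (K k)"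
        using pk by (intro emeasure_mono) (auto simp: borel_compact)
      also have "\<dots> < \<infinity>"
        using pk by (intro emeasure_bounded_finite compact_imp_bounded)
      finally show "finite_measure ?M"
        by (intro finite_measureI) (simp add: sp emeasure_restrict_space)
      show "integrable ?M (?F s)" if "s \<in> ?I" for s
        using integral_riem_volume(2)[OF A P g[OF that] _ _ k, of "indicator D" 1]
        by (subst integrable_restrict_space) (auto simp: indicator_def ac_simps)
      show "((\<lambda>s. ?F s x) has_real_derivative ?F' s x) (at s within ?I)" if "s \<in> ?I" "x \<in> space ?M" for s x
        using that pk unfolding sp
        by (intro DERIV_cmult vol_density_has_derivative[OF A flow]) auto
      have "(\<lambda>x. indicator D (chart_param (\<phi> k) x) * (- (?n / 2) * p t (chart_param (\<phi> k) x) * vol_density A (g t) (\<phi> k) x))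
          \<in> borel_measurable borel"
        by measurable
      then have "(\<lambda>x. indicator D (chart_param (\<phi> k) x) * (- (?n / 2) * p t (chart_param (\<phi> k) x) * vol_density A (g t) (\<phi> k) x))
          \<in> borel_measurable ?M"
        by (intro measurable_restrict_space1) simp
      then show "?F' t \<in> borel_measurable ?M"
        by (rule measurable_cong[THEN iffD1, rotated]) (simp add: sp param)
      show "\<bar>?F' s x\<bar> \<le> ?n / 2 * C" if "s \<in> ?I" "\<bar>s - t\<bar> < \<delta>" "x \<in> space ?M" for s x
      proof -
        have x: "x \<in> K k" using that pk by (auto simp: sp)
        have nn: "vol_density A (g s) (\<phi> k) x \<ge> 0"
          by (rule vol_density_nonneg[OF A pk(1) g[OF that(1)]])
        have "\<bar>?F' s x\<bar> \<le> ?n / 2 * (\<bar>p s (cinv (\<phi> k) x)\<bar> * vol_density A (g s) (\<phi> k) x)"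
          using nn by (auto simp: indicator_def abs_mult)
        also have "\<dots> \<le> ?n / 2 * C"
          using C[OF that(1,2) x] by (intro mult_left_mono) auto
        finally show ?thesis .
      qed
    qed (fact \<delta>)
    moreover have "(LINT x|?M. ?F' t x) = (LINT x|?M. indicator D (chart_param (\<phi> k) x) *
        (- (?n / 2) * p t (chart_param (\<phi> k) x) * vol_density A (g t) (\<phi> k) x))"
      by (intro Bochner_Integration.integral_cong refl) (simp add: sp param)
    ultimately show "((\<lambda>s. LINT x|lborel. ?w k x * vol_density A (g s) (\<phi> k) x) has_real_derivative
        (LINT x|lborel. ?w k x * (- (?n / 2) * p t (chart_param (\<phi> k) x) * vol_density A (g t) (\<phi> k) x))) (at t within ?I)"
      unfolding LINT by simp
  qed
  moreover have "(\<Sum>k<N. LINT x|lborel. ?w k x * (- (?n / 2) * p t (chart_param (\<phi> k) x) * vol_density A (g t) (\<phi> k) x))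
      = - (?n / 2) * (LINT q:D|riem_volume A (g t). p t q)"
  proof -
    have "(LINT q:D|riem_volume A (g t). p t q) = (\<Sum>k<N. LINT x|lborel. indicator (cmap (\<phi> k) ` P k) x
        * vol_density A (g t) (\<phi> k) x * (indicator D (chart_param (\<phi> k) x) * p t (chart_param (\<phi> k) x)))"
      unfolding set_lebesgue_integral_def real_scaleR_def
      by (rule integral_riem_volume(3)[OF A P g[OF t] _ Dp]) measurable
    then show ?thesis
      by (simp add: sum_distrib_left ac_simps flip: integral_mult_right_zero)
  qed
  ultimately have "((\<lambda>s. \<Sum>k<N. LINT x|lborel. ?w k x * vol_density A (g s) (\<phi> k) x) has_real_derivative
      - (?n / 2) * (LINT q:D|riem_volume A (g t). p t q)) (at t within ?I)"
    by simp
  then show ?thesis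
    by (rule has_field_derivative_transform_within[OF _ zero_less_one t]) (simp add: vol)
qed

text \<open>If the integral vanished, \<open>D\<close> would be a null set. In a chart that meets \<open>D\<close>, where the density
  is positive, a nonempty open set would then be negligible.\<close>

lemma integral_riem_volume_pos:
  fixes A :: "('m::topological_space, 'n::finite) chart set"
  assumes A: "smooth_atlas A" and M: "compact (UNIV :: 'm set)" and g: "g \<in> metrics A"
    and f: "f \<in> pos_smooth_funs A" and D: "open D" "D \<noteq> {}"
  shows "(LINT q:D|riem_volume A g. f q) > 0"
proof (rule ccontr)
  obtain N \<phi> K P where P: "chart_partition A N \<phi> K P"
    by (rule chart_partition_exists[OF A M])
  note sets = sets_riem_volume[OF A P g]
  have fs: "f \<in> smooth_funs A" and pos: "\<And>q. f q > 0"
    using f by (auto simp: pos_smooth_funs_def)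
  have cont: "continuous_on UNIV f"
    by (rule smooth_funs_continuous[OF A fs])
  obtain C where C: "\<And>q. \<bar>f q\<bar> \<le> C"
    using continuous_on_compact_space_bounded[OF cont M] by blast
  have [measurable]: "f \<in> borel_measurable borel" "D \<in> sets borel"
    using cont D by (auto intro: borel_measurable_continuous_onI)
  have "integrable (riem_volume A g) (\<lambda>q. indicator D q * f q)"
  proof (rule integral_riem_volume(1)[OF A P g])
    show "\<bar>indicator D q * f q\<bar> \<le> C" for q
      using C[of q] by (auto simp: indicator_def intro: order_trans[OF abs_ge_zero])
  qed measurable
  moreover have nn: "AE q in riem_volume A g. 0 \<le> indicator D q * f q"
    using pos by (intro AE_I2) (simp add: less_imp_le)
  moreover assume "\<not> (LINT q:D|riem_volume A g. f q) > 0"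
  then have "(LINT q|riem_volume A g. indicator D q * f q) = 0"
    using integral_nonneg_AE[OF nn] by (simp add: set_lebesgue_integral_def)
  ultimately have ae: "AE q in riem_volume A g. indicator D q * f q = 0"
    using integral_nonneg_eq_0_iff_AE by blast
  have "AE q in riem_volume A g. q \<notin> D"
    using ae by eventually_elim (use pos in \<open>auto simp: less_le indicator_def split: if_splits\<close>)
  then have D0: "emeasure (riem_volume A g) D = 0"
    using sets by (subst (asm) AE_iff_measurable[of D]) auto
  from D obtain q where q: "q \<in> D" by blast
  obtain c where c: "c \<in> A" "q \<in> cdom c" by (rule atlas_cover[OF A])
  let ?W = "D \<inter> cdom c"
  have W: "open ?W" "?W \<subseteq> cdom c"
    using D(1) chart_homeomorphism(1)[OF A c(1)] by auto
  have oW: "open (cmap c ` ?W)"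
    by (rule open_chart_image[OF A c(1) W(2,1)])
  have "emeasure (riem_volume A g) ?W \<le> emeasure (riem_volume A g) D"
    using sets D by (intro emeasure_mono) auto
  then have "(\<integral>\<^sup>+x \<in> cmap c ` ?W. ennreal (vol_density A g c x) \<partial>lborel) = 0"
    using D0 W by (subst emeasure_riem_volume[OF A P g c(1) _ W(2), symmetric]) auto
  then have "AE x in lborel. ennreal (vol_density A g c x) * indicator (cmap c ` ?W) x = 0"
    using vol_density_measurable[OF A c(1) g] oW by (subst (asm) nn_integral_0_iff_AE) auto
  then have "AE x in lborel. x \<notin> cmap c ` ?W"
  proof eventually_elim
    case (elim x)
    show ?case
    proof
      assume x: "x \<in> cmap c ` ?W"
      then have "x \<in> cimg c" using chart_inverse(1)[OF A c(1)] by blast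
      from vol_density_pos(2)[OF A c(1) g this] elim x show False by simp
    qed
  qed
  then have "cmap c ` ?W \<in> null_sets lborel"
    using oW by (subst (asm) AE_iff_null_sets[symmetric]) auto
  then have "negligible (cmap c ` ?W)"
    by (simp add: negligible_iff_null_sets null_sets_completionI)
  moreover have "cmap c ` ?W \<noteq> {}"
    using q c by blast
  ultimately show False
    using open_not_negligible[OF oW] by blast
qed

lemma strict_antimono_on_if_deriv_neg:
  fixes f f' :: "real \<Rightarrow> real"
  assumes I: "convex I"
    and der: "\<And>t. t \<in> I \<Longrightarrow> (f has_real_derivative f' t) (at t within I)"
    and neg: "\<And>t. t \<in> I \<Longrightarrow> f' t < 0"
  shows "strict_antimono_on I f"
proof (rule monotone_onI)
  fix s t assume st: "s \<in> I" "t \<in> I" "s < t"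
  have sub: "{s..t} \<subseteq> I"
    using I st by (metis closed_segment_eq_real_ivl1 convex_contains_segment less_imp_le)
  obtain x where x: "x \<in> {s<..<t}" "f t - f s = f' x * (t - s)"
    using mvt_simple[OF st(3), of f "\<lambda>x h. f' x * h"] der sub
    by (metis DERIV_subset atLeastAtMost_iff has_field_derivative_def subsetD)
  have "x \<in> I"
    using x(1) sub by auto
  then have "f' x * (t - s) < 0"
    using neg st(3) by (intro mult_neg_pos) auto
  with x show "f t < f s" by simp
qed

theorem theorem7p5:
  fixes A :: "('m::{t2_space,second_countable_topology}, 'n::finite) chart set"
    and T :: ereal
    and g :: "real \<Rightarrow> ('m, 'n) tensor2"
    and p :: "real \<Rightarrow> 'm \<Rightarrow> real"
    and D :: "'m set"
  assumes "CARD('n) \<ge> 3"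
    and "closed_connected_oriented_manifold A"
    and "conformal_ricci_flow A T g p"
    and "\<not> static_flow A T g p"
    and "\<forall>t\<in>time_dom T. p t \<in> pos_smooth_funs A"
    and "open D" and "connected D" and "D \<noteq> {}"
  shows "(\<forall>t\<in>time_dom T.
            ((\<lambda>s. vol A D (g s)) has_real_derivative
               - (real CARD('n) / 2) * (LINT q:D|riem_volume A (g t). p t q)) (at t within time_dom T) \<and>
            - (real CARD('n) / 2) * (LINT q:D|riem_volume A (g t). p t q) < 0) \<and>
         strict_antimono_on (time_dom T) (\<lambda>t. vol A D (g t)) \<and>
         (\<forall>t\<in>time_dom T.
            ((\<lambda>s. vol A UNIV (g s)) has_real_derivative
               - (real CARD('n) / 2) * (LINT q|riem_volume A (g t). p t q)) (at t within time_dom T) \<and>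
            - (real CARD('n) / 2) * (LINT q|riem_volume A (g t). p t q) < 0)"
proof -
  have A: "smooth_atlas A" and M: "compact (UNIV :: 'm set)"
    using assms(2) by (auto simp: closed_connected_oriented_manifold_def oriented_atlas_def)
  have g: "g t \<in> metrics A" if "t \<in> time_dom T" for t
    using assms(3) that by (auto simp: conformal_ricci_flow_def)
  have deriv: "((\<lambda>s. vol A E (g s)) has_real_derivative
      - (real CARD('n) / 2) * (LINT q:E|riem_volume A (g t). p t q)) (at t within time_dom T)"
    "- (real CARD('n) / 2) * (LINT q:E|riem_volume A (g t). p t q) < 0"
    if "open E" "E \<noteq> {}" "t \<in> time_dom T" for E t
  proof -
    show "((\<lambda>s. vol A E (g s)) has_real_derivative
        - (real CARD('n) / 2) * (LINT q:E|riem_volume A (g t). p t q)) (at t within time_dom T)"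
      using that by (intro vol_has_derivative[OF A M assms(3)]) auto
    have "(LINT q:E|riem_volume A (g t). p t q) > 0"
      using that assms(5) by (intro integral_riem_volume_pos[OF A M g]) auto
    then show "- (real CARD('n) / 2) * (LINT q:E|riem_volume A (g t). p t q) < 0"
      by simp
  qed
  have "strict_antimono_on (time_dom T) (\<lambda>t. vol A D (g t))"
    by (rule strict_antimono_on_if_deriv_neg[OF convex_time_dom deriv[OF assms(6,8)]])
  moreover have "(LINT q:UNIV|riem_volume A (g t). p t q) = (LINT q|riem_volume A (g t). p t q)" for t
    by (simp add: set_lebesgue_integral_def)
  ultimately show ?thesis
    using deriv[OF assms(6,8)] deriv[OF open_UNIV UNIV_not_empty] by simp
qed

end
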